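(* Let $n\ge 2$ and let $A\in\mathbb{C}^{n\times n}$ have eigenvalues $\lambda_1,\dots,\lambda_n$ (with multiplicity). Then there exist real numbers $\gamma_k$ ($2\le k\le \lfloor n/2\rfloor$), complex numbers $\lambda^{(2)}_j$ ($1\le j\le n-2$), and possibly infinite poles $\lambda^{(k+1)}_j\in\mathbb{C}^\star$ ($2\le k\le\lfloor n/2\rfloor$, $1\le j\le n-2k$), all independent of $p$ and $\theta$, such that for all $p,\theta\in\mathbb{R}$ $$\det\big(p(A)\big)=\prod_{j=1}^{n}p(\lambda_j)-\frac{t_1(A)}{4}\prod_{j=1}^{n-2}p\big(\lambda^{(2)}_j\big)+\sum_{k=2}^{\lfloor n/2\rfloor}\frac{\gamma_k}{4^k}\prod_{j=1}^{n-2k}p\big(\lambda^{(k+1)}_{j}\big).$$ Moreover, if $t_1(A)\neq 0$, the numbers $\lambda^{(2)}_1,\dots,\lambda^{(2)}_{n-2}$ are the solutions (with multiplicity) of the polynomial equation in $x$ $$\operatorname{tr}\big(\operatorname{adj}(xI-A)\,(A^\star-\bar A)\big)=0 .$$ (Empty sums equal $0$ and empty products equal $1$.)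
   Context: $A^\star$ is the conjugate transpose and $\operatorname{adj}$ the adjugate. $\operatorname{Re}A=\frac{A+A^\star}{2}$, $\operatorname{Im}A=\frac{A-A^\star}{2i}$. For real parameters $p,\theta$ (pedal coordinate with respect to the origin and tangential angle of an oriented line) and $a\in\mathbb{C}$, the pedal coordinate is $p(a):=p+\operatorname{Im}(e^{-i\theta}a)=p+\cos\theta\,\operatorname{Im}a-\sin\theta\,\operatorname{Re}a$. For a matrix $A$, $p(A):=pI+\cos\theta\,\operatorname{Im}A-\sin\theta\,\operatorname{Re}A$. Poles at infinity: $\mathbb{C}^\star:=\mathbb{C}\cup\{z\infty : z\in\mathbb{C}\}$, where $z\infty$ is a formal symbol and $p(z\infty):=\lim_{s\to\infty}p(sz)/s=p(z)-p=\operatorname{Im}(e^{-i\theta}z)$. The matrix $\bar A$ (not the entrywise conjugate) denotes any matrix satisfying: $\bar AA=A\bar A$; $\overline{Q^{-1}AQ}=Q^{-1}\bar AQ$ for all invertible $Q$; and $Au=\lambda u$ implies $\bar Au=\bar\lambda u$. It need not be unique, but one has $\operatorname{tr}(A^k\bar A)=\sum_j\lambda_j^k\bar\lambda_j$, and $\operatorname{tr}(\operatorname{adj}(xI-A)\bar A)=\det(xI-A)\sum_j\frac{\bar\lambda_j}{x-\lambda_j}$ for $x\notin\sigma(A)$, so the equation above does not depend on the choice. $t_k(A):=\operatorname{tr}\big(A^k(A^\star-\bar A)\big)=\operatorname{tr}(A^kA^\star)-\sum_{j=1}^n\lambda_j^k\bar\lambda_j$. *)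

theory Defs
  imports Complex_Main "Jordan_Normal_Form.Schur_Decomposition"
begin

definition mat_trace :: "complex mat \<Rightarrow> complex" where
  "mat_trace A = (\<Sum>i<dim_row A. A $$ (i, i))"

definition mat_Re :: "complex mat \<Rightarrow> complex mat" where
  "mat_Re A = (1 / 2) \<cdot>\<^sub>m (A + mat_adjoint A)"

definition mat_Im :: "complex mat \<Rightarrow> complex mat" where
  "mat_Im A = (1 / (2 * \<i>)) \<cdot>\<^sub>m (A - mat_adjoint A)"

definition pedal :: "real \<Rightarrow> real \<Rightarrow> complex \<Rightarrow> real" where
  "pedal p \<theta> a = p + Im (cis (- \<theta>) * a)"

lemma pedal_cos_sin: "pedal p \<theta> a = p + cos \<theta> * Im a - sin \<theta> * Re a"
  by (simp add: pedal_def)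

definition pedal_mat :: "real \<Rightarrow> real \<Rightarrow> complex mat \<Rightarrow> complex mat" where
  "pedal_mat p \<theta> A = complex_of_real p \<cdot>\<^sub>m 1\<^sub>m (dim_row A)
     + complex_of_real (cos \<theta>) \<cdot>\<^sub>m mat_Im A - complex_of_real (sin \<theta>) \<cdot>\<^sub>m mat_Re A"

text \<open>The points of the complex plane together with a formal symbol
  for \<open>z\<infinity>\<close>, one for every complex \<open>z\<close> (including \<open>z = 0\<close>).\<close>

datatype pole = Finite_Pole complex | Infinite_Pole complex

primrec pole_pedal :: "real \<Rightarrow> real \<Rightarrow> pole \<Rightarrow> real" where
  "pole_pedal p \<theta> (Finite_Pole a) = pedal p \<theta> a"
| "pole_pedal p \<theta> (Infinite_Pole z) =
     Lim at_top (\<lambda>s::real. pedal p \<theta> (complex_of_real s * z) / s)"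

lemma pole_pedal_infinite:
  "((\<lambda>s::real. pedal p \<theta> (complex_of_real s * z) / s) \<longlongrightarrow> Im (cis (- \<theta>) * z)) at_top"
  "pole_pedal p \<theta> (Infinite_Pole z) = Im (cis (- \<theta>) * z)"
proof -
  let ?c = "Im (cis (- \<theta>) * z)"
  have "((\<lambda>s::real. p / s) \<longlongrightarrow> 0) at_top"
    by (rule real_tendsto_divide_at_top[OF tendsto_const filterlim_ident])
  then have "((\<lambda>s::real. p / s + ?c) \<longlongrightarrow> 0 + ?c) at_top"
    by (intro tendsto_add tendsto_const)
  moreover have "\<forall>\<^sub>F s::real in at_top.
      p / s + ?c = pedal p \<theta> (complex_of_real s * z) / s"
    using eventually_gt_at_top[of 0]
    by eventually_elim (simp add: pedal_def field_simps)
  ultimately show lim: "((\<lambda>s::real. pedal p \<theta> (complex_of_real s * z) / s) \<longlongrightarrow> ?c) at_top"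
    by (simp add: tendsto_cong)
  show "pole_pedal p \<theta> (Infinite_Pole z) = ?c"
    using tendsto_Lim[OF _ lim] by simp
qed

text \<open>A choice of a matrix \<open>bar A\<close> for every complex \<open>n \<times> n\<close> matrix \<open>A\<close>. The second condition
  relates the choices made for similar matrices, so this is a property of the
  choice function rather than of a single matrix.\<close>

definition conj_operation :: "nat \<Rightarrow> (complex mat \<Rightarrow> complex mat) \<Rightarrow> bool" where
  "conj_operation n bar \<longleftrightarrow>
     (\<forall>A \<in> carrier_mat n n. bar A \<in> carrier_mat n n \<and> bar A * A = A * bar A) \<and>
     (\<forall>A \<in> carrier_mat n n. \<forall>Q \<in> carrier_mat n n. \<forall>Q' \<in> carrier_mat n n.
        inverts_mat Q Q' \<longrightarrow> inverts_mat Q' Q \<longrightarrow> bar (Q' * A * Q) = Q' * bar A * Q) \<and>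
     (\<forall>A \<in> carrier_mat n n. \<forall>u \<in> carrier_vec n. \<forall>c.
        A *\<^sub>v u = c \<cdot>\<^sub>v u \<longrightarrow> bar A *\<^sub>v u = cnj c \<cdot>\<^sub>v u)"

lemma interpolation_poly:
  fixes g :: "complex \<Rightarrow> complex"
  assumes "finite S"
  shows "\<exists>f :: complex poly. \<forall>x \<in> S. poly f x = g x"
  using assms
proof induction
  case (insert a S)
  then obtain f where f: "\<And>x. x \<in> S \<Longrightarrow> poly f x = g x" by blast
  define w where "w = (\<Prod>s\<in>S. [:- s, 1:])"
  have wS: "poly w x = 0" if "x \<in> S" for x
    using that insert by (auto simp: w_def poly_prod)
  have wa: "poly w a \<noteq> 0"
    using insert by (auto simp: w_def poly_prod)
  have "\<forall>x \<in> insert a S. poly (f + smult ((g a - poly f a) / poly w a) w) x = g x"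
    using f wS wa by auto
  then show ?case by blast
qed simp

lemma conj_operation_exists: "\<exists>bar. conj_operation n bar"
proof -
  define ev_mat :: "complex list \<Rightarrow> complex mat \<Rightarrow> complex mat" where
    "ev_mat cs A = foldr (\<lambda>c B. c \<cdot>\<^sub>m 1\<^sub>m n + A * B) cs (0\<^sub>m n n)" for cs A
  have ev_simps: "ev_mat [] A = 0\<^sub>m n n"
    "ev_mat (c # cs) A = c \<cdot>\<^sub>m 1\<^sub>m n + A * ev_mat cs A" for A c cs
    by (simp_all add: ev_mat_def)
  have carr: "ev_mat cs A \<in> carrier_mat n n" if "A \<in> carrier_mat n n" for A cs
    using that by (induction cs) (auto simp: ev_simps)
  have comm: "ev_mat cs A * A = A * ev_mat cs A" if A: "A \<in> carrier_mat n n" for A cs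
  proof (induction cs)
    case Nil
    then show ?case using A by (simp add: ev_simps)
  next
    case (Cons c cs)
    let ?E = "ev_mat cs A"
    have E: "?E \<in> carrier_mat n n" by (rule carr[OF A])
    have "(c \<cdot>\<^sub>m 1\<^sub>m n + A * ?E) * A = c \<cdot>\<^sub>m 1\<^sub>m n * A + A * ?E * A"
      using A E by (intro add_mult_distrib_mat) auto
    also have "A * ?E * A = A * (A * ?E)"
      using A E Cons.IH by (simp add: assoc_mult_mat[OF A E A])
    also have "c \<cdot>\<^sub>m 1\<^sub>m n * A = A * (c \<cdot>\<^sub>m 1\<^sub>m n)"
      using A by (simp add: mult_smult_distrib[OF A one_carrier_mat] mult_smult_assoc_mat[OF one_carrier_mat A])
    also have "A * (c \<cdot>\<^sub>m 1\<^sub>m n) + A * (A * ?E) = A * (c \<cdot>\<^sub>m 1\<^sub>m n + A * ?E)"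
      using A E by (intro mult_add_distrib_mat[symmetric]) auto
    finally show ?case by (simp add: ev_simps)
  qed
  have sim: "ev_mat cs (Q' * A * Q) = Q' * ev_mat cs A * Q"
    if A: "A \<in> carrier_mat n n" and Q: "Q \<in> carrier_mat n n" and Q': "Q' \<in> carrier_mat n n"
      and inv: "Q * Q' = 1\<^sub>m n" "Q' * Q = 1\<^sub>m n" for A Q Q' cs
  proof (induction cs)
    case Nil
    then show ?case using Q Q' by (simp add: ev_simps)
  next
    case (Cons c cs)
    let ?E = "ev_mat cs A"
    have E: "?E \<in> carrier_mat n n" by (rule carr[OF A])
    have "Q' * A * Q * (Q' * ?E * Q) = Q' * A * (Q * Q') * ?E * Q"
      using A Q Q' E by (simp add: assoc_mult_mat[of _ n n _ n _ n])
    also have "\<dots> = Q' * (A * ?E) * Q"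
      using A Q Q' E inv by (simp add: assoc_mult_mat[of _ n n _ n _ n])
    finally have 1: "Q' * A * Q * (Q' * ?E * Q) = Q' * (A * ?E) * Q" .
    have 2: "Q' * (c \<cdot>\<^sub>m 1\<^sub>m n) * Q = c \<cdot>\<^sub>m 1\<^sub>m n"
      using Q Q' inv
      by (simp add: mult_smult_distrib[OF Q' one_carrier_mat] mult_smult_assoc_mat[OF Q' Q])
    have "Q' * (c \<cdot>\<^sub>m 1\<^sub>m n + A * ?E) * Q = (Q' * (c \<cdot>\<^sub>m 1\<^sub>m n) + Q' * (A * ?E)) * Q"
      using A E Q' by (subst mult_add_distrib_mat[of _ n n _ n]) auto
    also have "\<dots> = Q' * (c \<cdot>\<^sub>m 1\<^sub>m n) * Q + Q' * (A * ?E) * Q"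
      using A E Q Q' by (intro add_mult_distrib_mat[of _ n n _ _ n]) auto
    finally show ?case using Cons.IH 1 2 by (simp add: ev_simps)
  qed
  have eig: "ev_mat (coeffs f) A *\<^sub>v u = poly f c \<cdot>\<^sub>v u"
    if A: "A \<in> carrier_mat n n" and u: "u \<in> carrier_vec n" and Au: "A *\<^sub>v u = c \<cdot>\<^sub>v u" for A u c f
  proof -
    have "ev_mat cs A *\<^sub>v u = foldr (\<lambda>a b. a + c * b) cs 0 \<cdot>\<^sub>v u" for cs
    proof (induction cs)
      case Nil
      then show ?case using u by (auto simp: ev_simps)
    next
      case (Cons a cs)
      have E: "ev_mat cs A \<in> carrier_mat n n" by (rule carr[OF A])
      let ?h = "foldr (\<lambda>a b. a + c * b) cs 0"
      have "(a \<cdot>\<^sub>m 1\<^sub>m n + A * ev_mat cs A) *\<^sub>v u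
          = (a \<cdot>\<^sub>m 1\<^sub>m n) *\<^sub>v u + (A * ev_mat cs A) *\<^sub>v u"
        using A E u by (intro add_mult_distrib_mat_vec) auto
      also have "(A * ev_mat cs A) *\<^sub>v u = A *\<^sub>v (?h \<cdot>\<^sub>v u)"
        using A E u Cons.IH by simp
      also have "\<dots> = ?h \<cdot>\<^sub>v (c \<cdot>\<^sub>v u)"
        using mult_mat_vec[OF A u] Au by simp
      also have "(a \<cdot>\<^sub>m 1\<^sub>m n) *\<^sub>v u = a \<cdot>\<^sub>v u"
      proof (rule eq_vecI)
        fix i assume "i < dim_vec (a \<cdot>\<^sub>v u)"
        then have i: "i < n" using u by simp
        have "((a \<cdot>\<^sub>m 1\<^sub>m n) *\<^sub>v u) $ i = (a \<cdot>\<^sub>v unit_vec n i) \<bullet> u"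
          using i by simp
        also have "\<dots> = a * u $ i"
          using u i by (subst smult_scalar_prod_distrib[of _ n]) auto
        finally show "((a \<cdot>\<^sub>m 1\<^sub>m n) *\<^sub>v u) $ i = (a \<cdot>\<^sub>v u) $ i"
          using u i by simp
      qed (use u in simp)
      finally have "ev_mat (a # cs) A *\<^sub>v u = a \<cdot>\<^sub>v u + ?h \<cdot>\<^sub>v (c \<cdot>\<^sub>v u)"
        by (simp only: ev_simps)
      also have "\<dots> = (a + c * ?h) \<cdot>\<^sub>v u"
        by (rule eq_vecI) (simp_all add: algebra_simps)
      finally show ?case by simp
    qed
    then show ?thesis by (simp add: poly_def horner_sum_foldr)
  qed
  have "\<exists>f :: complex poly. \<forall>x \<in> {x. poly P x = 0}. poly f x = cnj x"
    if "P \<noteq> 0" for P :: "complex poly"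
    by (rule interpolation_poly[OF poly_roots_finite[OF that]])
  then have "\<forall>P :: complex poly. \<exists>f :: complex poly.
      P \<noteq> 0 \<longrightarrow> (\<forall>x \<in> {x. poly P x = 0}. poly f x = cnj x)"
    by simp
  from choice[OF this] obtain F :: "complex poly \<Rightarrow> complex poly"
    where F: "\<And>P x. P \<noteq> 0 \<Longrightarrow> poly P x = 0 \<Longrightarrow> poly (F P) x = cnj x"
    by auto
  define bar where "bar A = ev_mat (coeffs (F (char_poly A))) A" for A
  have "conj_operation n bar"
    unfolding conj_operation_def
  proof (intro conjI ballI allI impI)
    fix A :: "complex mat" assume A: "A \<in> carrier_mat n n"
    show "bar A \<in> carrier_mat n n" "bar A * A = A * bar A"
      unfolding bar_def by (rule carr[OF A], rule comm[OF A])
  next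
    fix A Q Q' :: "complex mat"
    assume A: "A \<in> carrier_mat n n" and Q: "Q \<in> carrier_mat n n" and Q': "Q' \<in> carrier_mat n n"
      and "inverts_mat Q Q'" "inverts_mat Q' Q"
    then have inv: "Q * Q' = 1\<^sub>m n" "Q' * Q = 1\<^sub>m n" by (auto simp: inverts_mat_def)
    have "similar_mat (Q' * A * Q) A"
      unfolding similar_mat_def similar_mat_wit_def Let_def
      using A Q Q' inv by (intro exI[of _ Q'] exI[of _ Q]) auto
    then have "char_poly (Q' * A * Q) = char_poly A" by (rule char_poly_similar)
    then show "bar (Q' * A * Q) = Q' * bar A * Q"
      unfolding bar_def using sim[OF A Q Q' inv] by simp
  next
    fix A :: "complex mat" and u c
    assume A: "A \<in> carrier_mat n n" and u: "u \<in> carrier_vec n" and Au: "A *\<^sub>v u = c \<cdot>\<^sub>v u"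
    show "bar A *\<^sub>v u = cnj c \<cdot>\<^sub>v u"
    proof (cases "u = 0\<^sub>v n")
      case True
      have "bar A \<in> carrier_mat n n" unfolding bar_def by (rule carr[OF A])
      then show ?thesis using True by auto
    next
      case False
      then have "eigenvalue A c"
        using A u Au unfolding eigenvalue_def eigenvector_def by auto
      then have "poly (char_poly A) c = 0" using eigenvalue_root_char_poly[OF A] by simp
      moreover have "char_poly A \<noteq> 0" using degree_monic_char_poly[OF A] by auto
      ultimately show ?thesis unfolding bar_def using F eig[OF A u Au] by simp
    qed
  qed
  then show ?thesis by blast
qed

definition t_coeff :: "(complex mat \<Rightarrow> complex mat) \<Rightarrow> nat \<Rightarrow> complex mat \<Rightarrow> complex" where
  "t_coeff bar k A = mat_trace (A ^\<^sub>m k * (mat_adjoint A - bar A))"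

end

theory Submission
  imports Defs
begin

text \<open>
  With \<open>u = cis (- \<theta>) / (2 * \<i>)\<close> and \<open>v = cnj u\<close> one has \<open>p(A) = p I + u A + v A*\<close>, \<open>p(a) = p + u a + v cnj a\<close> and
  \<open>u v = 1/4\<close>. So \<open>F p u v = det (p I + u A + v A*)\<close> is a homogeneous form of degree \<open>n\<close> that is
  Hermitian, i.e. conjugation exchanges the roles of \<open>u\<close> and \<open>v\<close>. On \<open>v = 0\<close> a Hermitian form of degree
  \<open>m\<close> is a binary form, hence a product of linear factors, and the corresponding product of poles
  differs from it by \<open>u v\<close> times a Hermitian form of degree \<open>m - 2\<close>; iterating gives the expansion.
  Factors without \<open>p\<close> are the infinite poles.

  In the first step \<open>F = \<Prod> p(ev j) + u v F1\<close>, where Jacobi's formula identifies \<open>F1 x (-1) 0\<close> with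
  \<open>- tr (adj (x I - A) (A* - bar A))\<close>, a polynomial whose coefficient at \<open>x ^ (n - 2)\<close> is \<open>- t_1\<close>. If
  \<open>t_1 \<noteq> 0\<close>, all of its poles are finite. If \<open>t_1 = 0\<close>, the unitary Schur form of \<open>A\<close> is diagonal and
  already \<open>F = \<Prod> p(ev j)\<close>.
\<close>

section \<open>Hermitian ternary forms\<close>

text \<open>Forms are functions of three complex arguments rather than elements of a polynomial
  ring. Generation by monomials of exact degree and by sums turns closure and divisibility
  properties into inductions with two cases.\<close>

inductive hom_form :: "nat \<Rightarrow> (complex \<Rightarrow> complex \<Rightarrow> complex \<Rightarrow> complex) \<Rightarrow> bool" where
  monomial: "m = a + b + c \<Longrightarrow> hom_form m (\<lambda>p u v. k * p ^ a * u ^ b * v ^ c)"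
| add: "hom_form m F \<Longrightarrow> hom_form m G \<Longrightarrow> hom_form m (\<lambda>p u v. F p u v + G p u v)"

lemma hom_form_zero: "hom_form m (\<lambda>p u v. 0)"
  using hom_form.monomial[of m m 0 0 0] by simp

lemma hom_form_linear: "hom_form 1 (\<lambda>p u v. x * p + y * u + z * v)"
  using hom_form.add[OF hom_form.add[OF hom_form.monomial[of 1 1 0 0 x] hom_form.monomial[of 1 0 1 0 y]]
      hom_form.monomial[of 1 0 0 1 z]]
  by simp

lemma hom_form_mult_monomial:
  assumes "hom_form l G" "m = a + b + c"
  shows "hom_form (m + l) (\<lambda>p u v. k * p ^ a * u ^ b * v ^ c * G p u v)"
  using assms(1)
proof (induction rule: hom_form.induct)
  case (monomial l a' b' c' k')
  have "hom_form (m + l) (\<lambda>p u v. (k * k') * p ^ (a + a') * u ^ (b + b') * v ^ (c + c'))"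
    by (rule hom_form.monomial) (use monomial assms(2) in simp)
  then show ?case by (simp add: power_add mult_ac)
next
  case (add l G H)
  then show ?case using hom_form.add[OF add.IH] by (simp add: distrib_left)
qed

lemma hom_form_mult:
  assumes "hom_form m F" "hom_form l G"
  shows "hom_form (m + l) (\<lambda>p u v. F p u v * G p u v)"
  using assms(1)
proof (induction rule: hom_form.induct)
  case (monomial m a b c k)
  then show ?case by (rule hom_form_mult_monomial[OF assms(2)])
next
  case (add m F H)
  then show ?case using hom_form.add[OF add.IH] by (simp add: distrib_right)
qed

lemma hom_form_scale:
  assumes "hom_form m F"
  shows "hom_form m (\<lambda>p u v. k * F p u v)"
  using hom_form_mult_monomial[OF assms, of 0 0 0 0 k] by simp

lemma hom_form_diff:
  assumes "hom_form m F" "hom_form m G"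
  shows "hom_form m (\<lambda>p u v. F p u v - G p u v)"
  using hom_form.add[OF assms(1) hom_form_scale[OF assms(2), of "-1"]] by simp

lemma hom_form_sum:
  assumes "\<And>i. i \<in> S \<Longrightarrow> hom_form m (F i)"
  shows "hom_form m (\<lambda>p u v. \<Sum>i\<in>S. F i p u v)"
  using assms
proof (induction S rule: infinite_finite_induct)
  case (insert i S)
  then show ?case using hom_form.add[of m "F i" "\<lambda>p u v. \<Sum>i\<in>S. F i p u v"] by simp
qed (simp_all add: hom_form_zero)

lemma hom_form_prod:
  assumes "finite S" "\<And>i. i \<in> S \<Longrightarrow> hom_form 1 (F i)"
  shows "hom_form (card S) (\<lambda>p u v. \<Prod>i\<in>S. F i p u v)"
  using assms
proof (induction S)
  case empty
  then show ?case using hom_form.monomial[of 0 0 0 0 1] by simp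
next
  case (insert i S)
  then show ?case using hom_form_mult[of 1 "F i" "card S" "\<lambda>p u v. \<Prod>i\<in>S. F i p u v"] by simp
qed

lemma hom_form_prod_list:
  assumes "\<And>x. x \<in> set xs \<Longrightarrow> hom_form 1 (F x)"
  shows "hom_form (length xs) (\<lambda>p u v. \<Prod>x\<leftarrow>xs. F x p u v)"
  using assms
proof (induction xs)
  case Nil
  then show ?case using hom_form.monomial[of 0 0 0 0 1] by simp
next
  case (Cons x xs)
  then show ?case using hom_form_mult[of 1 "F x" "length xs" "\<lambda>p u v. \<Prod>x\<leftarrow>xs. F x p u v"] by simp
qed

text \<open>Exchanging \<open>u\<close> with \<open>v\<close> and conjugating coefficients turns a
  monomial into one of the same degree. This provides the mirror image that symmetrises a quotient
  in \<open>hermitian_form_split\<close>.\<close>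

lemma hom_form_conj_swap:
  assumes "hom_form m F"
  shows "hom_form m (\<lambda>p u v. cnj (F (cnj p) (cnj v) (cnj u)))"
  using assms
proof (induction rule: hom_form.induct)
  case (monomial m a b c k)
  have "hom_form m (\<lambda>p u v. cnj k * p ^ a * u ^ c * v ^ b)"
    by (rule hom_form.monomial) (use monomial in simp)
  then show ?case by (simp add: mult_ac)
next
  case (add m F G)
  then show ?case using hom_form.add[OF add.IH] by simp
qed

text \<open>In the Leibniz expansion every matrix entry is a linear form in \<open>p\<close>,
  \<open>u\<close>, \<open>v\<close>, so each permutation contributes a product of \<open>n\<close>
  linear forms.\<close>

lemma hom_form_det:
  assumes A: "A \<in> carrier_mat n n" and B: "B \<in> carrier_mat n n"
  shows "hom_form n (\<lambda>p u v. det (p \<cdot>\<^sub>m 1\<^sub>m n + u \<cdot>\<^sub>m A + v \<cdot>\<^sub>m B))"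
proof -
  let ?L = "\<lambda>\<pi> i p u v. 1\<^sub>m n $$ (i, \<pi> i) * p + A $$ (i, \<pi> i) * u + B $$ (i, \<pi> i) * v"
  have "hom_form n (\<lambda>p u v. \<Sum>\<pi> | \<pi> permutes {0..<n}. signof \<pi> * (\<Prod>i\<in>{0..<n}. ?L \<pi> i p u v))"
    by (intro hom_form_sum hom_form_scale)
       (use hom_form_prod[of "{0..<n}", OF _ hom_form_linear] in simp)
  also have "(\<lambda>p u v. \<Sum>\<pi> | \<pi> permutes {0..<n}. signof \<pi> * (\<Prod>i\<in>{0..<n}. ?L \<pi> i p u v))
      = (\<lambda>p u v. det (p \<cdot>\<^sub>m 1\<^sub>m n + u \<cdot>\<^sub>m A + v \<cdot>\<^sub>m B))"
  proof (intro ext)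
    fix p u v
    have M: "p \<cdot>\<^sub>m 1\<^sub>m n + u \<cdot>\<^sub>m A + v \<cdot>\<^sub>m B \<in> carrier_mat n n" using A B by simp
    show "(\<Sum>\<pi> | \<pi> permutes {0..<n}. signof \<pi> * (\<Prod>i\<in>{0..<n}. ?L \<pi> i p u v))
        = det (p \<cdot>\<^sub>m 1\<^sub>m n + u \<cdot>\<^sub>m A + v \<cdot>\<^sub>m B)"
      unfolding det_def'[OF M]
    proof (intro sum.cong refl arg_cong2[where f = "(*)"] prod.cong)
      fix \<pi> i assume "\<pi> \<in> {\<pi>. \<pi> permutes {0..<n}}" "i \<in> {0..<n}"
      then have "i < n" "\<pi> i < n" by (auto dest: permutes_in_image[of \<pi> _ i])
      then show "?L \<pi> i p u v = (p \<cdot>\<^sub>m 1\<^sub>m n + u \<cdot>\<^sub>m A + v \<cdot>\<^sub>m B) $$ (i, \<pi> i)"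
        using A B by simp
    qed
  qed
  finally show ?thesis .
qed

section \<open>Restriction to v = 0 and divisibility by u v\<close>

lemma hom_form_poly_third:
  assumes "hom_form m F"
  shows "\<exists>g :: complex poly. \<forall>v. F p u v = poly g v"
  using assms
proof (induction rule: hom_form.induct)
  case (monomial m a b c k)
  then show ?case by (intro exI[of _ "monom (k * p ^ a * u ^ b) c"]) (simp add: poly_monom)
next
  case (add m F G)
  then obtain f g where "\<forall>v. F p u v = poly f v" "\<forall>v. G p u v = poly g v" by auto
  then show ?case by (intro exI[of _ "f + g"]) simp
qed

text \<open>The sign makes a linear factor \<open>p + u a\<close> correspond to the root \<open>a\<close> of \<open>f\<close>.\<close>

lemma hom_form_restrict:
  assumes "hom_form m F"
  shows "\<exists>f :: complex poly. degree f \<le> m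
    \<and> (\<forall>p u. F p u 0 = (\<Sum>i\<le>m. coeff f i * p ^ i * (- u) ^ (m - i)))"
  using assms
proof (induction rule: hom_form.induct)
  case (monomial m a b c k)
  show ?case
  proof (cases "c = 0")
    case True
    \<comment> \<open>The factor (-1)^b cancels the sign of (- u)^b, and for \<open>c = 0\<close>
      the exponent \<open>m - a\<close> equals \<open>b\<close>.\<close>
    have "k * p ^ a * u ^ b
        = (\<Sum>i\<le>m. coeff (monom (k * (-1) ^ b) a) i * p ^ i * (- u) ^ (m - i))" for p u :: complex
    proof -
      have "(\<Sum>i\<le>m. coeff (monom (k * (-1) ^ b) a) i * p ^ i * (- u) ^ (m - i))
          = (\<Sum>i\<le>m. if i = a then k * (-1) ^ b * p ^ a * (- u) ^ b else 0)"
        using True monomial by (intro sum.cong) auto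
      also have "\<dots> = k * p ^ a * ((-1) ^ b * (- u) ^ b)"
        using True monomial by (simp add: sum.delta mult_ac)
      also have "(-1) ^ b * (- u) ^ b = u ^ b"
        by (simp flip: power_mult_distrib)
      finally show ?thesis by simp
    qed
    then show ?thesis using True monomial
      by (intro exI[of _ "monom (k * (-1) ^ b) a"]) (simp add: degree_monom_le order_trans[OF degree_monom_le])
  \<comment> \<open>With \<open>c > 0\<close> the monomial vanishes at \<open>v = 0\<close>, so the
    zero polynomial serves.\<close>
  qed (auto intro!: exI[of _ 0])
next
  case (add m F G)
  then obtain f g where "degree f \<le> m" "degree g \<le> m"
    "\<forall>p u. F p u 0 = (\<Sum>i\<le>m. coeff f i * p ^ i * (- u) ^ (m - i))"
    "\<forall>p u. G p u 0 = (\<Sum>i\<le>m. coeff g i * p ^ i * (- u) ^ (m - i))" by auto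
  then show ?case
    by (intro exI[of _ "f + g"]) (simp add: degree_add_le distrib_right sum.distrib)
qed

lemma poly_altdef':
  fixes f :: "complex poly"
  assumes "degree f \<le> m"
  shows "poly f x = (\<Sum>i\<le>m. coeff f i * x ^ i)"
  unfolding poly_altdef using assms by (intro sum.mono_neutral_left) (auto simp: coeff_eq_0)

text \<open>At \<open>u = -1\<close> all powers of \<open>- u\<close> are 1; at \<open>u = 0\<close>
  only the summand \<open>i = m\<close> survives, because 0^0 = 1. The second value is the leading
  coefficient of \<open>f\<close> when its degree is exactly \<open>m\<close>.\<close>

lemma restrict_at_minus_one:
  fixes f :: "complex poly"
  assumes "degree f \<le> m" "\<forall>p u. F p u 0 = (\<Sum>i\<le>m. coeff f i * p ^ i * (- u) ^ (m - i))"
  shows "F x (-1) 0 = poly f x" "F 1 0 0 = coeff f m"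
proof -
  show "F x (-1) 0 = poly f x"
    unfolding poly_altdef'[OF assms(1)] using assms(2) by simp
  have "F 1 0 0 = (\<Sum>i\<le>m. if i = m then coeff f m else 0)"
    unfolding assms(2)[rule_format] by (intro sum.cong) (auto simp: power_0_left)
  then show "F 1 0 0 = coeff f m" by simp
qed

text \<open>A monomial containing both \<open>u\<close> and \<open>v\<close> is divisible by their
  product. Pure powers of \<open>p\<close> occur in both restrictions, whence the subtraction of
  \<open>F p 0 0\<close>. Since \<open>m - 2\<close> is truncated, the clause for
  \<open>m < 2\<close> records that no quotient remains there.\<close>

lemma hom_form_split_uv:
  assumes "hom_form m F"
  shows "\<exists>F'. hom_form (m - 2) F' \<and> (m < 2 \<longrightarrow> F' = (\<lambda>p u v. 0))
    \<and> (\<forall>p u v. F p u v = F p u 0 + F p 0 v - F p 0 0 + u * v * F' p u v)"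
  using assms
proof (induction rule: hom_form.induct)
  case (monomial m a b c k)
  show ?case
  proof (cases "b = 0 \<or> c = 0")
    case True
    then show ?thesis by (intro exI[of _ "\<lambda>p u v. 0"]) (auto simp: hom_form_zero power_0_left)
  next
    case False
    have "hom_form (m - 2) (\<lambda>p u v. k * p ^ a * u ^ (b - 1) * v ^ (c - 1))"
      by (rule hom_form.monomial) (use False monomial in simp)
    moreover have "u ^ b = u * u ^ (b - 1)" "v ^ c = v * v ^ (c - 1)" for u v :: complex
      using False by (simp_all add: power_eq_if)
    ultimately show ?thesis using False monomial
      by (intro exI[of _ "\<lambda>p u v. k * p ^ a * u ^ (b - 1) * v ^ (c - 1)"]) (auto simp: mult_ac)
  qed
next
  case (add m F G)
  then obtain F' G' where
    F: "hom_form (m - 2) F'" "m < 2 \<longrightarrow> F' = (\<lambda>p u v. 0)"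
       "\<And>p u v. F p u v = F p u 0 + F p 0 v - F p 0 0 + u * v * F' p u v" and
    G: "hom_form (m - 2) G'" "m < 2 \<longrightarrow> G' = (\<lambda>p u v. 0)"
       "\<And>p u v. G p u v = G p u 0 + G p 0 v - G p 0 0 + u * v * G' p u v"
    by blast
  show ?case
  proof (intro exI conjI allI)
    fix p u v
    show "F p u v + G p u v = F p u 0 + G p u 0 + (F p 0 v + G p 0 v) - (F p 0 0 + G p 0 0)
       + u * v * (F' p u v + G' p u v)"
      by (subst F(3), subst G(3)) (simp add: algebra_simps)
  qed (use F(2) G(2) hom_form.add[OF F(1) G(1)] in auto)
qed

section \<open>Hermitian forms and division by u v\<close>

definition hermitian_form :: "(complex \<Rightarrow> complex \<Rightarrow> complex \<Rightarrow> complex) \<Rightarrow> bool" where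
  "hermitian_form F \<longleftrightarrow> (\<forall>p u v. F (cnj p) (cnj v) (cnj u) = cnj (F p u v))"

lemma hermitian_formD: "hermitian_form F \<Longrightarrow> F (cnj p) (cnj v) (cnj u) = cnj (F p u v)"
  by (simp add: hermitian_form_def)

text \<open>By homogeneity the difference of the two forms vanishes on all of \<open>v = 0\<close>,
  by Hermitian symmetry also on \<open>u = 0\<close>, so \<open>u v\<close> divides it.\<close>

lemma hermitian_form_split:
  assumes F: "hom_form m F" "hermitian_form F" and G: "hom_form m G" "hermitian_form G"
    and eq: "\<And>x. F x (-1) 0 = G x (-1) 0"
  shows "\<exists>F'. hom_form (m - 2) F' \<and> hermitian_form F' \<and> (m < 2 \<longrightarrow> F' = (\<lambda>p u v. 0))
    \<and> (\<forall>p u v. F p u v = G p u v + u * v * F' p u v)"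
proof -
  define H where "H p u v = F p u v - G p u v" for p u v
  have H: "hom_form m H" unfolding H_def[abs_def] by (rule hom_form_diff[OF F(1) G(1)])
  have hH: "H (cnj p) (cnj v) (cnj u) = cnj (H p u v)" for p u v
    using F(2) G(2) by (simp add: H_def hermitian_formD)
  obtain f where f: "degree f \<le> m"
      "\<forall>p u. H p u 0 = (\<Sum>i\<le>m. coeff f i * p ^ i * (- u) ^ (m - i))"
    using hom_form_restrict[OF H] by blast
  have "poly f x = 0" for x
    using restrict_at_minus_one(1)[where F = H, OF f, of x] eq by (simp add: H_def)
  then have "f = 0" using poly_all_0_iff_0 by blast
  then have u0: "H p u 0 = 0" for p u using f(2) by simp
  have v0: "H p 0 v = 0" for p v
    using hH[of "cnj p" "0" "cnj v"] u0 hH[of "cnj p" "cnj v" 0] by simp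
  obtain K where K: "hom_form (m - 2) K" "m < 2 \<longrightarrow> K = (\<lambda>p u v. 0)"
      "\<And>p u v. H p u v = H p u 0 + H p 0 v - H p 0 0 + u * v * K p u v"
    using hom_form_split_uv[OF H] by blast
  have HK: "H p u v = u * v * K p u v" for p u v
    using K(3)[of p u v] by (simp add: u0 v0)
  \<comment> \<open>The quotient \<open>K\<close> is not known to be Hermitian. Its mirror image
    \<open>K'\<close> is a quotient as well, and the average of the two is Hermitian by
    construction.\<close>
  define K' where "K' p u v = cnj (K (cnj p) (cnj v) (cnj u))" for p u v
  have HK': "H p u v = u * v * K' p u v" for p u v
  proof -
    have "H p u v = cnj (H (cnj p) (cnj v) (cnj u))"
      unfolding hH by simp
    also have "\<dots> = u * v * K' p u v"
      by (subst HK) (simp add: K'_def)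
    finally show ?thesis .
  qed
  have K': "hom_form (m - 2) K'" unfolding K'_def[abs_def] by (rule hom_form_conj_swap[OF K(1)])
  show ?thesis
  proof (intro exI[of _ "\<lambda>p u v. 1 / 2 * (K p u v + K' p u v)"] conjI allI)
    show "hom_form (m - 2) (\<lambda>p u v. 1 / 2 * (K p u v + K' p u v))"
      by (rule hom_form_scale[OF hom_form.add[OF K(1) K']])
    show "hermitian_form (\<lambda>p u v. 1 / 2 * (K p u v + K' p u v))"
      by (simp add: hermitian_form_def K'_def)
    show "m < 2 \<longrightarrow> (\<lambda>p u v. 1 / 2 * (K p u v + K' p u v)) = (\<lambda>p u v. 0)"
      using K(2) by (auto simp: K'_def)
    fix p u v
    have "F p u v - G p u v = u * v * (1 / 2 * (K p u v + K' p u v))"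
      using HK[of p u v] HK'[of p u v] by (simp add: H_def field_simps)
    then show "F p u v = G p u v + u * v * (1 / 2 * (K p u v + K' p u v))"
      by (simp add: algebra_simps)
  qed
qed

section \<open>Linear forms of poles and the iterated expansion\<close>

primrec pole_form :: "pole \<Rightarrow> complex \<Rightarrow> complex \<Rightarrow> complex \<Rightarrow> complex" where
  "pole_form (Finite_Pole a) p u v = p + u * a + v * cnj a"
| "pole_form (Infinite_Pole z) p u v = u * z + v * cnj z"

lemma hom_form_pole_form: "hom_form 1 (pole_form P)"
proof (cases P)
  case (Finite_Pole a)
  have "pole_form P = (\<lambda>p u v. 1 * p + a * u + cnj a * v)"
    using Finite_Pole by (simp add: fun_eq_iff)
  then show ?thesis using hom_form_linear[of 1 a "cnj a"] by simp
next
  case (Infinite_Pole z)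
  have "pole_form P = (\<lambda>p u v. 0 * p + z * u + cnj z * v)"
    using Infinite_Pole by (simp add: fun_eq_iff)
  then show ?thesis using hom_form_linear[of 0 z "cnj z"] by simp
qed

lemma hermitian_prod_poles:
  "hom_form (length ps) (\<lambda>p u v. of_real c * (\<Prod>P\<leftarrow>ps. pole_form P p u v))"
  "hermitian_form (\<lambda>p u v. of_real c * (\<Prod>P\<leftarrow>ps. pole_form P p u v))"
proof -
  show "hom_form (length ps) (\<lambda>p u v. of_real c * (\<Prod>P\<leftarrow>ps. pole_form P p u v))"
    by (intro hom_form_scale hom_form_prod_list hom_form_pole_form)
  have 1: "pole_form P (cnj p) (cnj v) (cnj u) = cnj (pole_form P p u v)" for P p u v
    by (cases P) (simp_all add: add_ac mult_ac)
  have "(\<Prod>P\<leftarrow>ps. pole_form P (cnj p) (cnj v) (cnj u)) = cnj (\<Prod>P\<leftarrow>ps. pole_form P p u v)" for p u v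
    by (induction ps) (simp_all add: 1)
  then show "hermitian_form (\<lambda>p u v. of_real c * (\<Prod>P\<leftarrow>ps. pole_form P p u v))"
    by (simp add: hermitian_form_def)
qed

lemma prod_linear_factors_poles:
  "poly (\<Prod>a\<leftarrow>as. [:- a, 1:]) x = (\<Prod>P\<leftarrow>map Finite_Pole as. pole_form P x (-1) 0)"
  by (induction as) (simp_all add: algebra_simps)

text \<open>The fundamental theorem of algebra factors the restriction to \<open>v = 0\<close>;
  factors lost by a drop of the degree below \<open>m\<close> become infinite poles. The constant is
  kept real so that the product of poles is again a Hermitian form.\<close>

lemma hermitian_form_pole_factors:
  assumes F: "hom_form m F" "hermitian_form F"
  shows "\<exists>(c :: real) ps. length ps = m
    \<and> (\<forall>x. F x (-1) 0 = of_real c * (\<Prod>P\<leftarrow>ps. pole_form P x (-1) 0))"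
proof -
  obtain f where f: "degree f \<le> m"
      "\<forall>p u. F p u 0 = (\<Sum>i\<le>m. coeff f i * p ^ i * (- u) ^ (m - i))"
    using hom_form_restrict[OF F(1)] by blast
  note Ff = restrict_at_minus_one[where F = F, OF f]
  define c where "c = lead_coeff f"
  obtain as where as: "smult c (\<Prod>a\<leftarrow>as. [:- a, 1:]) = f" and len: "length as = degree f"
    using fundamental_theorem_algebra_factorized[of f] unfolding c_def by blast
  have Fx: "F x (-1) 0 = c * (\<Prod>P\<leftarrow>map Finite_Pole as. pole_form P x (-1) 0)" for x
    unfolding Ff(1) prod_linear_factors_poles[symmetric] by (subst as[symmetric]) simp
  show ?thesis
  proof (cases "degree f = m")
    case True
    \<comment> \<open>At full degree the leading coefficient is \<open>F 1 0 0\<close>, which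
      Hermitian symmetry makes real.\<close>
    have "cnj (F 1 0 0) = F 1 0 0"
      using hermitian_formD[OF F(2), of 1 0 0] by simp
    then have "of_real (Re c) = c"
      using True Ff(2) by (simp add: c_def complex_eq_iff)
    then show ?thesis
      using Fx len True by (intro exI[of _ "Re c"] exI[of _ "map Finite_Pole as"]) simp
  next
    case False
    \<comment> \<open>The form of an infinite pole z takes the value -z at \<open>u = -1\<close>,
      \<open>v = 0\<close>. The pole with z = - c absorbs the leading coefficient, which may be
      non-real here, and the other \<open>d\<close> poles contribute 1 each.\<close>
    define d where "d = m - degree f - 1"
    have "F x (-1) 0 = of_real 1 * (\<Prod>P\<leftarrow>map Finite_Pole as @ Infinite_Pole (- c)
        # replicate d (Infinite_Pole (-1)). pole_form P x (-1) 0)" for x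
      unfolding Fx by simp
    then show ?thesis
      using False f(1) len d_def
      by (intro exI[of _ 1] exI[of _ "map Finite_Pole as @ Infinite_Pole (- c)
        # replicate d (Infinite_Pole (-1))"]) simp
  qed
qed

text \<open>Each round matches the form on \<open>v = 0\<close> by a product of poles and leaves
  \<open>u v\<close> times a Hermitian form of degree lower by two, to which the induction
  hypothesis applies.\<close>

lemma hermitian_form_expansion:
  assumes "hom_form m F" "hermitian_form F"
  shows "\<exists>(\<gamma> :: nat \<Rightarrow> real) ps. (\<forall>k \<le> m div 2. length (ps k) = m - 2 * k) \<and>
    (\<forall>p u v. F p u v = (\<Sum>k\<le>m div 2. of_real (\<gamma> k) * (u * v) ^ k * (\<Prod>P\<leftarrow>ps k. pole_form P p u v)))"
  using assms
proof (induction m arbitrary: F rule: less_induct)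
  case (less m)
  obtain c qs where qs: "length qs = m"
      "\<And>x. F x (-1) 0 = of_real c * (\<Prod>P\<leftarrow>qs. pole_form P x (-1) 0)"
    using hermitian_form_pole_factors[OF less.prems] by blast
  note G = hermitian_prod_poles[where ps = qs and c = c]
  obtain F' where F': "hom_form (m - 2) F'" "hermitian_form F'" "m < 2 \<longrightarrow> F' = (\<lambda>p u v. 0)"
     "\<And>p u v. F p u v = of_real c * (\<Prod>P\<leftarrow>qs. pole_form P p u v) + u * v * F' p u v"
    using hermitian_form_split[OF less.prems G[unfolded qs(1)] qs(2)] by blast
  show ?case
  proof (cases "m < 2")
    case True
    then have "m div 2 = 0" by simp
    then show ?thesis using F' True qs
      by (intro exI[of _ "\<lambda>_. c"] exI[of _ "\<lambda>_. qs"]) simp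
  next
    case False
    then obtain \<gamma> ps where IH: "\<And>k. k \<le> (m - 2) div 2 \<Longrightarrow> length (ps k) = m - 2 - 2 * k"
      "\<And>p u v. F' p u v = (\<Sum>k\<le>(m - 2) div 2. of_real (\<gamma> k) * (u * v) ^ k * (\<Prod>P\<leftarrow>ps k. pole_form P p u v))"
      using less.IH[OF _ F'(1,2)] by (auto simp: linorder_not_less)
    have m2: "m div 2 = Suc ((m - 2) div 2)" using False by simp
    show ?thesis
    proof (intro exI conjI allI impI)
      fix k assume "k \<le> m div 2"
      \<comment> \<open>\<open>case_nat\<close> puts the new product at index 0 and shifts the data
        of the quotient up by one.\<close>
      then show "length (case_nat qs ps k) = m - 2 * k"
        using IH(1) qs(1) m2 by (cases k) auto
    next
      fix p u v
      show "F p u v = (\<Sum>k\<le>m div 2. of_real (case_nat c \<gamma> k) * (u * v) ^ k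
          * (\<Prod>P\<leftarrow>case_nat qs ps k. pole_form P p u v))"
        unfolding m2 sum.atMost_Suc_shift
        by (simp add: F'(4)[of p u v] IH(2)[of p u v] sum_distrib_left mult_ac)
    qed
  qed
qed

section \<open>Unitary triangularisation\<close>

lemma index_mult_mat_sum:
  assumes "A \<in> carrier_mat n m" "B \<in> carrier_mat m l" "i < n" "j < l"
  shows "(A * B) $$ (i, j) = (\<Sum>k<m. A $$ (i, k) * B $$ (k, j))"
  using assms by (simp add: scalar_prod_def atLeast0LessThan)

lemma mat_adjoint_dim [simp]:
  "dim_row (mat_adjoint A) = dim_col A" "dim_col (mat_adjoint A) = dim_row A"
  by (simp_all add: mat_adjoint_def)

lemma mat_adjoint_carrier [simp]: "A \<in> carrier_mat n m \<Longrightarrow> mat_adjoint A \<in> carrier_mat m n"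
  by (rule carrier_matI) auto

lemma mat_adjoint_index [simp]:
  fixes A :: "complex mat"
  assumes "A \<in> carrier_mat n m" "i < m" "j < n"
  shows "mat_adjoint A $$ (i, j) = cnj (A $$ (j, i))"
  using assms by (simp add: mat_adjoint_def mat_of_rows_def)

lemma mat_adjoint_mult:
  fixes A B :: "complex mat"
  assumes "A \<in> carrier_mat n m" "B \<in> carrier_mat m l"
  shows "mat_adjoint (A * B) = mat_adjoint B * mat_adjoint A"
proof (rule eq_matI)
  fix i j assume "i < dim_row (mat_adjoint B * mat_adjoint A)" "j < dim_col (mat_adjoint B * mat_adjoint A)"
  then have ij: "i < l" "j < n" using assms by auto
  have AB: "A * B \<in> carrier_mat n l" using assms by simp
  show "mat_adjoint (A * B) $$ (i, j) = (mat_adjoint B * mat_adjoint A) $$ (i, j)"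
    unfolding mat_adjoint_index[OF AB ij] index_mult_mat_sum[OF assms ij(2,1)]
      index_mult_mat_sum[OF mat_adjoint_carrier[OF assms(2)] mat_adjoint_carrier[OF assms(1)] ij]
    using assms ij by (simp add: mult.commute)
qed (use assms in auto)

lemma mat_adjoint_adjoint:
  fixes A :: "complex mat"
  assumes "A \<in> carrier_mat n m"
  shows "mat_adjoint (mat_adjoint A) = A"
proof (rule eq_matI)
  fix i j assume "i < dim_row A" "j < dim_col A"
  then have "i < n" "j < m" using assms by auto
  then show "mat_adjoint (mat_adjoint A) $$ (i, j) = A $$ (i, j)"
    using mat_adjoint_index[OF mat_adjoint_carrier[OF assms]] mat_adjoint_index[OF assms] by simp
qed auto

lemma upper_triangular_mult:
  fixes A B :: "'a :: semiring_0 mat"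
  assumes A: "A \<in> carrier_mat n n" "upper_triangular A" and B: "B \<in> carrier_mat n n" "upper_triangular B"
  shows "upper_triangular (A * B)"
    and "i < n \<Longrightarrow> (A * B) $$ (i, i) = A $$ (i, i) * B $$ (i, i :: nat)"
proof -
  have z: "A $$ (i, j) = 0" "B $$ (i, j) = 0" if "i < n" "j < i" for i j
    using that A B by (auto dest: upper_triangularD)
  show "upper_triangular (A * B)"
  proof (rule upper_triangularI)
    fix i j assume ij: "j < i" "i < dim_row (A * B)"
    then have "i < n" "j < n" using A by auto
    then show "(A * B) $$ (i, j) = 0"
      unfolding index_mult_mat_sum[OF A(1) B(1) \<open>i < n\<close> \<open>j < n\<close>]
    proof (intro sum.neutral ballI)
      fix k assume "k \<in> {..<n}"
      then have "A $$ (i, k) = 0 \<or> B $$ (k, j) = 0"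
        using z(1)[OF \<open>i < n\<close>, of k] z(2)[of k j] ij(1) by (cases "k < i") auto
      then show "A $$ (i, k) * B $$ (k, j) = 0"
        by auto
    qed
  qed
  assume i: "i < n"
  have "A $$ (i, k) * B $$ (k, i) = (if k = i then A $$ (i, i) * B $$ (i, i) else 0)" if "k < n" for k
  proof (cases "k = i")
    case False
    then have "A $$ (i, k) = 0 \<or> B $$ (k, i) = 0"
      using z(1)[OF i] z(2)[OF that] by (meson linorder_neqE_nat)
    then show ?thesis using False by auto
  qed simp
  then have "(A * B) $$ (i, i) = (\<Sum>k<n. if k = i then A $$ (i, i) * B $$ (i, i) else 0)"
    unfolding index_mult_mat_sum[OF A(1) B(1) i i] by (intro sum.cong) auto
  then show "(A * B) $$ (i, i) = A $$ (i, i) * B $$ (i, i)" using i by simp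
qed

section \<open>Gram-Schmidt on a triangularising basis\<close>

definition triangular_similarity ::
  "nat \<Rightarrow> complex list \<Rightarrow> complex mat \<Rightarrow> complex mat \<Rightarrow> complex mat \<Rightarrow> complex mat \<Rightarrow> bool" where
  "triangular_similarity n es A T P Q \<longleftrightarrow>
     T \<in> carrier_mat n n \<and> P \<in> carrier_mat n n \<and> Q \<in> carrier_mat n n \<and>
     P * Q = 1\<^sub>m n \<and> Q * P = 1\<^sub>m n \<and> A = P * T * Q \<and>
     upper_triangular T \<and> (\<forall>i<n. T $$ (i, i) = es ! i)"

lemma triangular_similarity_exists:
  assumes A: "A \<in> carrier_mat n n" and "char_poly A = (\<Prod>e\<leftarrow>es. [:- e, 1:])"
  shows "\<exists>T P Q. triangular_similarity n es A T P Q"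
proof -
  obtain T P Q where S: "schur_decomposition A es = (T, P, Q)" by (metis prod_cases3)
  have s: "similar_mat_wit A T P Q" "upper_triangular T" "diag_mat T = es"
    using schur_decomposition[OF A assms(2) S] by auto
  note w = similar_mat_witD2[OF A s(1)]
  have "T $$ (i, i) = es ! i" if "i < n" for i
    using that s(3) w by (auto simp: diag_mat_def)
  then show ?thesis using s w unfolding triangular_similarity_def by blast
qed

text \<open>Upper triangular base changes keep \<open>T\<close> upper triangular, and the diagonals
  of \<open>E\<close> and \<open>F\<close> are reciprocal, so the diagonal of \<open>T\<close>
  survives. Gram-Schmidt steps and normalisations are of this kind.\<close>

lemma triangular_similarity_conj:
  assumes S: "triangular_similarity n es A T P Q"
    and E: "E \<in> carrier_mat n n" "upper_triangular E" and F: "F \<in> carrier_mat n n" "upper_triangular F"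
    and EF: "E * F = 1\<^sub>m n" "F * E = 1\<^sub>m n"
  shows "triangular_similarity n es A (F * T * E) (P * E) (F * Q)"
proof -
  have T: "T \<in> carrier_mat n n" "upper_triangular T" "\<And>i. i < n \<Longrightarrow> T $$ (i, i) = es ! i"
    and P: "P \<in> carrier_mat n n" and Q: "Q \<in> carrier_mat n n"
    and PQ: "P * Q = 1\<^sub>m n" "Q * P = 1\<^sub>m n" "A = P * T * Q"
    using S unfolding triangular_similarity_def by auto
  have FT: "F * T \<in> carrier_mat n n" "upper_triangular (F * T)"
    using F T upper_triangular_mult(1)[OF F T(1,2)] by auto
  have "(F * T * E) $$ (i, i) = es ! i" if i: "i < n" for i
  proof -
    have "F $$ (i, i) * E $$ (i, i) = 1"
      using upper_triangular_mult(2)[OF F E i] i unfolding EF by simp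
    then show ?thesis
      using upper_triangular_mult(2)[OF FT E i] upper_triangular_mult(2)[OF F T(1,2) i] T(3)[OF i]
      by (simp add: mult_ac)
  qed
  moreover have "P * E * (F * Q) = 1\<^sub>m n"
  proof -
    have "P * E * (F * Q) = P * (E * F) * Q"
      using P E(1) F(1) Q by (simp add: assoc_mult_mat[of _ n n _ n _ n])
    then show ?thesis using P PQ by (simp add: EF)
  qed
  moreover have "F * Q * (P * E) = 1\<^sub>m n"
  proof -
    have "F * Q * (P * E) = F * (Q * P) * E"
      using P E(1) F(1) Q by (simp add: assoc_mult_mat[of _ n n _ n _ n])
    then show ?thesis using F(1) EF by (simp add: PQ)
  qed
  moreover have "A = P * E * (F * T * E) * (F * Q)"
  proof -
    have "P * E * (F * T * E) * (F * Q) = P * (E * F) * T * (E * F) * Q"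
      using P E(1) F(1) Q T(1) by (simp add: assoc_mult_mat[of _ n n _ n _ n])
    then show ?thesis using P T(1) PQ by (simp add: EF)
  qed
  ultimately show ?thesis
    using P Q E(1) F(1) T(1) upper_triangular_mult(1)[OF FT E] unfolding triangular_similarity_def by auto
qed

text \<open>Right multiplication adds to column \<open>k\<close> the combination of the preceding
  columns with weights \<open>c\<close>: one Gram-Schmidt step as an upper triangular matrix with
  unit diagonal.\<close>

definition col_op_mat :: "nat \<Rightarrow> nat \<Rightarrow> (nat \<Rightarrow> complex) \<Rightarrow> complex mat" where
  "col_op_mat n k c = mat n n (\<lambda>(i, j). (if i = j then 1 else 0) + (if j = k \<and> i < k then c i else 0))"

lemma col_op_mat:
  shows "col_op_mat n k c \<in> carrier_mat n n" "upper_triangular (col_op_mat n k c)"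
  by (auto simp: col_op_mat_def intro!: upper_triangularI)

lemma mult_col_op_mat:
  assumes P: "P \<in> carrier_mat n n" and k: "k < n" and ij: "i < n" "j < n"
  shows "(P * col_op_mat n k c) $$ (i, j) = P $$ (i, j) + (if j = k then \<Sum>l<k. P $$ (i, l) * c l else 0)"
proof -
  have "(P * col_op_mat n k c) $$ (i, j) = (\<Sum>l<n. P $$ (i, l) *
      ((if l = j then 1 else 0) + (if j = k \<and> l < k then c l else 0)))"
    unfolding index_mult_mat_sum[OF P col_op_mat(1) ij]
    using ij by (intro sum.cong) (auto simp: col_op_mat_def)
  also have "\<dots> = (\<Sum>l<n. (if l = j then P $$ (i, l) else 0)
      + (if j = k then if l < k then P $$ (i, l) * c l else 0 else 0))"
    by (intro sum.cong) auto
  also have "\<dots> = P $$ (i, j) + (if j = k then \<Sum>l<n. if l < k then P $$ (i, l) * c l else 0 else 0)"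
    using ij unfolding sum.distrib by simp
  also have "(\<Sum>l<n. if l < k then P $$ (i, l) * c l else 0) = (\<Sum>l<k. P $$ (i, l) * c l)"
    using k by (intro sum.mono_neutral_cong_right) auto
  finally show ?thesis .
qed

lemma col_op_mat_inverse:
  assumes k: "k < n"
  shows "col_op_mat n k c * col_op_mat n k (\<lambda>i. - c i) = 1\<^sub>m n"
proof (rule eq_matI)
  fix i j assume "i < dim_row (1\<^sub>m n :: complex mat)" "j < dim_col (1\<^sub>m n :: complex mat)"
  then have ij: "i < n" "j < n" by auto
  have "(\<Sum>l<k. col_op_mat n k c $$ (i, l) * - c l) = (\<Sum>l<k. if l = i then - c i else 0)"
    using k ij by (intro sum.cong) (auto simp: col_op_mat_def)
  then show "(col_op_mat n k c * col_op_mat n k (\<lambda>i. - c i)) $$ (i, j) = 1\<^sub>m n $$ (i, j)"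
    unfolding mult_col_op_mat[OF col_op_mat(1) k ij] using ij
    by (auto simp: col_op_mat_def)
qed (auto simp: col_op_mat_def)

definition col_ip :: "complex mat \<Rightarrow> nat \<Rightarrow> nat \<Rightarrow> complex" where
  "col_ip P i j = (\<Sum>l<dim_row P. cnj (P $$ (l, i)) * P $$ (l, j))"

lemma col_ip_commute: "col_ip P j i = cnj (col_ip P i j)"
  by (simp add: col_ip_def mult.commute)

lemma col_ip_self: "col_ip P i i = of_real (\<Sum>l<dim_row P. (cmod (P $$ (l, i)))\<^sup>2)"
  unfolding col_ip_def of_real_sum by (intro sum.cong) (simp_all add: complex_norm_square mult.commute flip: of_real_power)

text \<open>A zero column of \<open>P\<close> would make the diagonal entry \<open>(i, i)\<close> of
  \<open>Q * P\<close> vanish.\<close>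

lemma col_ip_self_pos:
  assumes P: "P \<in> carrier_mat n n" "Q \<in> carrier_mat n n" "Q * P = 1\<^sub>m n" and i: "i < n"
  shows "(\<Sum>l<dim_row P. (cmod (P $$ (l, i)))\<^sup>2) > 0"
proof (rule ccontr)
  assume "\<not> ?thesis"
  then have "(\<Sum>l<dim_row P. (cmod (P $$ (l, i)))\<^sup>2) = 0"
    by (meson sum_nonneg zero_le_power2 order_antisym not_less)
  then have "P $$ (l, i) = 0" if "l < n" for l
    using that P(1) by (simp add: sum_nonneg_eq_0_iff)
  then have "(Q * P) $$ (i, i) = 0"
    unfolding index_mult_mat_sum[OF P(2,1) i i] by simp
  then show False using i by (simp add: P(3))
qed

text \<open>Gram-Schmidt without normalisation, treating one further column per induction step;
  \<open>triangular_similarity_conj\<close> keeps the similarity triangular.\<close>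

lemma triangular_similarity_orthogonal:
  assumes A: "A \<in> carrier_mat n n" and c: "char_poly A = (\<Prod>e\<leftarrow>es. [:- e, 1:])" and "k \<le> n"
  shows "\<exists>T P Q. triangular_similarity n es A T P Q \<and> (\<forall>i<k. \<forall>j<k. i \<noteq> j \<longrightarrow> col_ip P i j = 0)"
  using assms(3)
proof (induction k)
  case 0
  then show ?case using triangular_similarity_exists[OF A c] by simp
next
  case (Suc k)
  then obtain T P Q where S: "triangular_similarity n es A T P Q"
    and orth: "\<And>i j. i < k \<Longrightarrow> j < k \<Longrightarrow> i \<noteq> j \<Longrightarrow> col_ip P i j = 0"
    by auto
  have P: "P \<in> carrier_mat n n" and Q: "Q \<in> carrier_mat n n" "Q * P = 1\<^sub>m n"
    using S unfolding triangular_similarity_def by auto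
  have kn: "k < n" using Suc by simp
  \<comment> \<open>These weights subtract from column \<open>k\<close> its projections onto the
    earlier columns; the denominators are their squared norms.\<close>
  define c where "c i = - col_ip P i k / col_ip P i i" for i
  define E where "E = col_op_mat n k c"
  define F where "F = col_op_mat n k (\<lambda>i. - c i)"
  have EF: "E * F = 1\<^sub>m n" "F * E = 1\<^sub>m n"
    using col_op_mat_inverse[OF kn, of c] col_op_mat_inverse[OF kn, of "\<lambda>i. - c i"] by (simp_all add: E_def F_def)
  have E: "E \<in> carrier_mat n n" "upper_triangular E" and F: "F \<in> carrier_mat n n" "upper_triangular F"
    by (simp_all add: E_def F_def col_op_mat)
  have S': "triangular_similarity n es A (F * T * E) (P * E) (F * Q)"
    by (rule triangular_similarity_conj[OF S E F EF])
  have PE: "(P * E) $$ (i, j) = P $$ (i, j) + (if j = k then \<Sum>l<k. P $$ (i, l) * c l else 0)"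
    if "i < n" "j < n" for i j
    unfolding E_def by (rule mult_col_op_mat[OF P kn that])
  have old: "col_ip (P * E) i j = col_ip P i j" if "i < k" "j < k" for i j
    using that kn P by (auto simp: col_ip_def PE simp del: index_mult_mat(1) intro!: sum.cong)
  have new: "col_ip (P * E) i k = 0" if i: "i < k" for i
  proof -
    have "col_ip (P * E) i k = (\<Sum>r<n. cnj (P $$ (r, i)) * (P $$ (r, k) + (\<Sum>l<k. P $$ (r, l) * c l)))"
      using i kn P by (auto simp: col_ip_def PE simp del: index_mult_mat(1) intro!: sum.cong)
    also have "\<dots> = col_ip P i k + (\<Sum>r<n. \<Sum>l<k. cnj (P $$ (r, i)) * P $$ (r, l) * c l)"
      using P by (simp add: col_ip_def distrib_left sum.distrib sum_distrib_left mult_ac)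
    also have "(\<Sum>r<n. \<Sum>l<k. cnj (P $$ (r, i)) * P $$ (r, l) * c l) = (\<Sum>l<k. col_ip P i l * c l)"
      using P by (subst sum.swap) (simp add: col_ip_def sum_distrib_right)
    also have "\<dots> = (\<Sum>l<k. if l = i then col_ip P i i * c i else 0)"
      using orth[OF i] by (intro sum.cong) auto
    also have "\<dots> = - col_ip P i k"
    proof -
      have "col_ip P i i \<noteq> 0"
        using i kn col_ip_self_pos[OF P Q, of i] unfolding col_ip_self of_real_eq_0_iff by simp
      then show ?thesis using i by (simp add: c_def)
    qed
    finally show ?thesis by simp
  qed
  have "col_ip (P * E) i j = 0" if "i < Suc k" "j < Suc k" "i \<noteq> j" for i j
    using that old[of i j] orth[of i j] new[of i] new[of j] col_ip_commute[of "P * E" i j]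
    by (auto simp: less_Suc_eq)
  then show ?case using S' by blast
qed

text \<open>Once the columns are orthogonal, dividing them by their norms is a diagonal, hence upper
  triangular, base change that makes the basis unitary.\<close>

lemma unitary_schur:
  fixes A :: "complex mat"
  assumes A: "A \<in> carrier_mat n n" and c: "char_poly A = (\<Prod>e\<leftarrow>es. [:- e, 1:])"
  shows "\<exists>U T. U \<in> carrier_mat n n \<and> T \<in> carrier_mat n n \<and> U * mat_adjoint U = 1\<^sub>m n \<and> mat_adjoint U * U = 1\<^sub>m n
    \<and> A = U * T * mat_adjoint U \<and> upper_triangular T \<and> (\<forall>i<n. T $$ (i, i) = es ! i)"
proof -
  obtain T P Q where S: "triangular_similarity n es A T P Q"
    and orth: "\<And>i j. i < n \<Longrightarrow> j < n \<Longrightarrow> i \<noteq> j \<Longrightarrow> col_ip P i j = 0"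
    using triangular_similarity_orthogonal[OF A c order.refl] by auto
  have P: "P \<in> carrier_mat n n" and Q: "Q \<in> carrier_mat n n" "Q * P = 1\<^sub>m n"
    using S unfolding triangular_similarity_def by auto
  define r where "r i = sqrt (\<Sum>l<dim_row P. (cmod (P $$ (l, i)))\<^sup>2)" for i
  have r: "r i > 0" "col_ip P i i = of_real (r i) * of_real (r i)" if "i < n" for i
    using col_ip_self_pos[OF P Q that] col_ip_self[of P i]
    by (simp_all add: r_def flip: of_real_mult)
  define D where "D f = mat n n (\<lambda>(i, j). if i = j then complex_of_real (f i) else 0)" for f
  have D: "D f \<in> carrier_mat n n" "upper_triangular (D f)" for f
    by (auto simp: D_def intro!: upper_triangularI)
  have D_dim: "dim_row (D f) = n" "dim_col (D f) = n" for f
    by (simp_all add: D_def)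
  have mult_D: "(M * D f) $$ (i, j) = M $$ (i, j) * of_real (f j)"
    if "M \<in> carrier_mat n n" "i < n" "j < n" for M f i j
  proof -
    have "(M * D f) $$ (i, j) = (\<Sum>l<n. if l = j then M $$ (i, j) * of_real (f j) else 0)"
      unfolding index_mult_mat_sum[OF that(1) D(1) that(2,3)]
      using that by (intro sum.cong) (auto simp: D_def)
    then show ?thesis using that by simp
  qed
  define E where "E = D (\<lambda>i. 1 / r i)"
  define F where "F = D r"
  have EF: "E * F = 1\<^sub>m n" "F * E = 1\<^sub>m n"
  proof -
    have "(E * F) $$ (i, j) = 1\<^sub>m n $$ (i, j)" "(F * E) $$ (i, j) = 1\<^sub>m n $$ (i, j)"
      if "i < n" "j < n" for i j
      unfolding E_def F_def mult_D[OF D(1) that] using that r(1)[of j] by (auto simp: D_def)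
    then show "E * F = 1\<^sub>m n" "F * E = 1\<^sub>m n"
      by (auto simp: E_def F_def D_dim intro!: eq_matI simp del: index_mult_mat(1))
  qed
  define U where "U = P * E"
  have S': "triangular_similarity n es A (F * T * E) U (F * Q)"
    unfolding U_def by (rule triangular_similarity_conj[OF S _ _ _ _ EF]) (simp_all add: E_def F_def D)
  have U: "U \<in> carrier_mat n n" "U * (F * Q) = 1\<^sub>m n" "F * Q \<in> carrier_mat n n"
    using S' unfolding triangular_similarity_def by auto
  have UU: "mat_adjoint U * U = 1\<^sub>m n"
  proof (rule eq_matI)
    fix i j assume "i < dim_row (1\<^sub>m n :: complex mat)" "j < dim_col (1\<^sub>m n :: complex mat)"
    then have ij: "i < n" "j < n" by auto
    have "(mat_adjoint U * U) $$ (i, j) = (\<Sum>l<n. cnj (U $$ (l, i)) * U $$ (l, j))"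
      unfolding index_mult_mat_sum[OF mat_adjoint_carrier[OF U(1)] U(1) ij]
      using ij U(1) by (intro sum.cong) auto
    also have "\<dots> = (\<Sum>l<n. cnj (P $$ (l, i)) * P $$ (l, j) * (1 / (of_real (r i) * of_real (r j))))"
      using ij P by (intro sum.cong) (simp_all add: U_def E_def mult_D del: index_mult_mat(1))
    also have "\<dots> = col_ip P i j / (of_real (r i) * of_real (r j))"
      using P by (simp add: col_ip_def sum_divide_distrib)
    also have "\<dots> = 1\<^sub>m n $$ (i, j)"
      using ij orth[OF ij] r by (cases "i = j") (auto simp: less_imp_neq[symmetric])
    finally show "(mat_adjoint U * U) $$ (i, j) = 1\<^sub>m n $$ (i, j)" .
  qed (use U(1) mat_adjoint_carrier[OF U(1)] in auto)
  \<comment> \<open>\<open>F * Q\<close> is a right inverse of \<open>U\<close> and the adjoint is a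
    left inverse, so they coincide.\<close>
  have "mat_adjoint U = mat_adjoint U * (U * (F * Q))"
    unfolding U(2) by (rule right_mult_one_mat[OF mat_adjoint_carrier[OF U(1)], symmetric])
  also have "\<dots> = F * Q"
    unfolding assoc_mult_mat[OF mat_adjoint_carrier[OF U(1)] U(1) U(3), symmetric] UU
    by (rule left_mult_one_mat[OF U(3)])
  finally have "mat_adjoint U = F * Q" .
  then show ?thesis
    using S' UU U unfolding triangular_similarity_def by (intro exI[of _ U] exI[of _ "F * T * E"]) auto
qed

section \<open>Traces of powers times the conjugated matrix\<close>

lemma mat_trace_mult:
  assumes "A \<in> carrier_mat n n" "B \<in> carrier_mat n n"
  shows "mat_trace (A * B) = (\<Sum>i<n. \<Sum>j<n. A $$ (i, j) * B $$ (j, i))"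
  using assms by (auto simp: mat_trace_def index_mult_mat_sum[OF assms] simp del: index_mult_mat(1) intro!: sum.cong)

lemma mat_trace_mult_commute:
  assumes "A \<in> carrier_mat n n" "B \<in> carrier_mat n n"
  shows "mat_trace (A * B) = mat_trace (B * A)"
proof -
  have "mat_trace (A * B) = (\<Sum>j<n. \<Sum>i<n. A $$ (i, j) * B $$ (j, i))"
    unfolding mat_trace_mult[OF assms] by (rule sum.swap)
  also have "\<dots> = mat_trace (B * A)"
    unfolding mat_trace_mult[OF assms(2,1)] by (intro sum.cong refl mult.commute)
  finally show ?thesis .
qed

lemma mat_trace_similar:
  assumes "P \<in> carrier_mat n n" "T \<in> carrier_mat n n" "Q \<in> carrier_mat n n" "Q * P = 1\<^sub>m n"
  shows "mat_trace (P * T * Q) = mat_trace T"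
proof -
  have "mat_trace (P * T * Q) = mat_trace (Q * (P * T))"
    by (rule mat_trace_mult_commute) (use assms in auto)
  also have "Q * (P * T) = Q * P * T" by (rule assoc_mult_mat[symmetric]) (use assms in auto)
  finally show ?thesis using assms by simp
qed

lemma mat_trace_minus:
  assumes "A \<in> carrier_mat n n" "B \<in> carrier_mat n n"
  shows "mat_trace (A - B) = mat_trace A - mat_trace B"
  using assms by (auto simp: mat_trace_def sum_subtractf)

lemma mat_trace_smult:
  assumes "A \<in> carrier_mat n n"
  shows "mat_trace (c \<cdot>\<^sub>m A) = c * mat_trace A"
  using assms by (auto simp: mat_trace_def sum_distrib_left)

lemma mat_trace_triangular_similarity:
  assumes "triangular_similarity n es A T P Q"
  shows "mat_trace A = (\<Sum>i<n. es ! i)"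
proof -
  have "mat_trace A = mat_trace T"
    using assms mat_trace_similar[of P n T Q] unfolding triangular_similarity_def by simp
  then show ?thesis using assms unfolding triangular_similarity_def mat_trace_def by auto
qed

text \<open>Every root of the characteristic polynomial is an eigenvalue and so equals 0, and the
  trace is the sum of these roots.\<close>

lemma mat_trace_zero_spectrum:
  assumes X: "X \<in> carrier_mat n n"
    and zero: "\<And>v c. v \<in> carrier_vec n \<Longrightarrow> v \<noteq> 0\<^sub>v n \<Longrightarrow> X *\<^sub>v v = c \<cdot>\<^sub>v v \<Longrightarrow> c = 0"
  shows "mat_trace X = 0"
proof -
  obtain es where es: "char_poly X = (\<Prod>e\<leftarrow>es. [:- e, 1:])" "length es = n"
    using char_poly_factorized[OF X] by blast
  have "e = 0" if "e \<in> set es" for e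
  proof -
    have "poly (char_poly X) e = 0"
      unfolding es(1) using that by (induction es) auto
    then obtain v where "v \<in> carrier_vec n" "v \<noteq> 0\<^sub>v n" "X *\<^sub>v v = e \<cdot>\<^sub>v v"
      using eigenvalue_root_char_poly[OF X] X unfolding eigenvalue_def eigenvector_def by auto
    then show ?thesis by (rule zero)
  qed
  then have "(\<Sum>i<n. es ! i) = 0"
    using es(2) by (intro sum.neutral) auto
  then show ?thesis
    using triangular_similarity_exists[OF X es(1)] mat_trace_triangular_similarity by metis
qed

text \<open>Commutation makes the eigenspace of \<open>X\<close> for \<open>c\<close> invariant
  under \<open>T\<close>. The induction is on a bound for the support of \<open>v\<close>: if
  \<open>v\<close> is not an eigenvector of \<open>T\<close>, a nonzero vector of the same
  eigenspace with a smaller bound replaces it.\<close>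

lemma common_eigenvector:
  assumes T: "T \<in> carrier_mat n n" "upper_triangular T" and X: "X \<in> carrier_mat n n"
    and XT: "X * T = T * X"
    and v: "v \<in> carrier_vec n" "v \<noteq> 0\<^sub>v n" "X *\<^sub>v v = c \<cdot>\<^sub>v v"
  shows "\<exists>w d. w \<in> carrier_vec n \<and> w \<noteq> 0\<^sub>v n \<and> X *\<^sub>v w = c \<cdot>\<^sub>v w \<and> T *\<^sub>v w = (d :: complex) \<cdot>\<^sub>v w"
proof -
  have "\<exists>w d. w \<in> carrier_vec n \<and> w \<noteq> 0\<^sub>v n \<and> X *\<^sub>v w = c \<cdot>\<^sub>v w \<and> T *\<^sub>v w = d \<cdot>\<^sub>v w"
    if "i \<le> n" "v \<in> carrier_vec n" "v \<noteq> 0\<^sub>v n" "X *\<^sub>v v = c \<cdot>\<^sub>v v" "\<And>l. l < n \<Longrightarrow> i \<le> l \<Longrightarrow> v $ l = 0"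
    for i v
    using that
  proof (induction i arbitrary: v)
    case 0
    then have "v = 0\<^sub>v n" by (intro eq_vecI) auto
    then show ?case using 0 by simp
  next
    case (Suc i)
    note v = Suc.prems(2)
    \<comment> \<open>Since \<open>T\<close> is triangular and \<open>v\<close> is supported on
      indices up to \<open>i\<close>, entry \<open>i\<close> of \<open>w\<close> cancels.\<close>
    define w where "w = T *\<^sub>v v - T $$ (i, i) \<cdot>\<^sub>v v"
    have w: "w \<in> carrier_vec n" using T v by (auto simp: w_def)
    show ?case
    proof (cases "w = 0\<^sub>v n")
      case True
      have "T *\<^sub>v v = T $$ (i, i) \<cdot>\<^sub>v v"
      proof (rule eq_vecI)
        fix l assume "l < dim_vec (T $$ (i, i) \<cdot>\<^sub>v v)"
        then have l: "l < n" using v by simp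
        then have "w $ l = 0" using True by simp
        then show "(T *\<^sub>v v) $ l = (T $$ (i, i) \<cdot>\<^sub>v v) $ l"
          using T v l by (simp add: w_def)
      qed (use T v in simp)
      then show ?thesis using Suc.prems by blast
    next
      case False
      have "X *\<^sub>v (T *\<^sub>v v) = (X * T) *\<^sub>v v" using X T v by simp
      also have "\<dots> = T *\<^sub>v (X *\<^sub>v v)" unfolding XT using X T v by simp
      also have "\<dots> = c \<cdot>\<^sub>v (T *\<^sub>v v)" using T v by (simp add: Suc.prems(4) mult_mat_vec)
      finally have XTv: "X *\<^sub>v (T *\<^sub>v v) = c \<cdot>\<^sub>v (T *\<^sub>v v)" .
      have Tv: "T *\<^sub>v v \<in> carrier_vec n" using T v by simp
      have "X *\<^sub>v w = X *\<^sub>v (T *\<^sub>v v) - X *\<^sub>v (T $$ (i, i) \<cdot>\<^sub>v v)"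
        unfolding w_def by (rule mult_minus_distrib_mat_vec[OF X Tv]) (use v in simp)
      also have "\<dots> = c \<cdot>\<^sub>v (T *\<^sub>v v) - T $$ (i, i) \<cdot>\<^sub>v (c \<cdot>\<^sub>v v)"
        using X v by (simp add: XTv Suc.prems(4) mult_mat_vec)
      also have "\<dots> = c \<cdot>\<^sub>v w"
        using Tv v T by (intro eq_vecI) (auto simp: w_def algebra_simps)
      finally have Xw: "X *\<^sub>v w = c \<cdot>\<^sub>v w" .
      have "w $ l = 0" if l: "l < n" "i \<le> l" for l
      proof -
        have "(T *\<^sub>v v) $ l = (\<Sum>j<n. T $$ (l, j) * v $ j)"
          using T v l by (simp add: scalar_prod_def atLeast0LessThan)
        also have "\<dots> = (\<Sum>j<n. if j = l then T $$ (i, i) * v $ l else 0)"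
        proof (intro sum.cong refl)
          fix j assume j: "j \<in> {..<n}"
          have "T $$ (l, j) = 0" if "j < l" using T l that by (auto dest: upper_triangularD)
          moreover have "v $ j = 0" if "l < j" using that l j Suc.prems(5)[of j] by simp
          moreover have "v $ l = 0" if "l \<noteq> i" using that l Suc.prems(5)[of l] by simp
          ultimately show "T $$ (l, j) * v $ j = (if j = l then T $$ (i, i) * v $ l else 0)"
            by (cases j l rule: linorder_cases; cases "l = i") auto
        qed
        also have "\<dots> = T $$ (i, i) * v $ l" using l by simp
        finally show ?thesis using T v l by (simp add: w_def)
      qed
      then show ?thesis using Suc.IH[OF _ w False Xw] Suc.prems(1) by simp
    qed
  qed
  from this[OF order.refl v] show ?thesis by simp
qed

lemma upper_triangular_pow:
  fixes T :: "complex mat"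
  assumes T: "T \<in> carrier_mat n n" "upper_triangular T"
  shows "upper_triangular (T ^\<^sub>m k)" "i < n \<Longrightarrow> (T ^\<^sub>m k) $$ (i, i) = T $$ (i, i) ^ k"
proof (induction k)
  case 0
  case 1 show ?case using T by simp
  case 2 then show ?case using T by simp
next
  case (Suc k)
  have c: "T ^\<^sub>m k \<in> carrier_mat n n" using T by simp
  case 1 show ?case using upper_triangular_mult(1)[OF c Suc(1) T] by simp
  case 2 then show ?case using upper_triangular_mult(2)[OF c Suc(1) T] Suc(2) by (simp del: index_mult_mat(1))
qed

lemma pow_mat_commute:
  fixes T X :: "complex mat"
  assumes T: "T \<in> carrier_mat n n" and X: "X \<in> carrier_mat n n" and TX: "T * X = X * T"
  shows "T ^\<^sub>m k * X = X * T ^\<^sub>m k"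
proof (induction k)
  case 0
  then show ?case using T X by simp
next
  case (Suc k)
  have c: "T ^\<^sub>m k \<in> carrier_mat n n" using T by simp
  have "T ^\<^sub>m Suc k * X = T ^\<^sub>m k * (X * T)"
    unfolding pow_mat.simps TX[symmetric] by (rule assoc_mult_mat[OF c T X])
  also have "\<dots> = X * T ^\<^sub>m k * T"
    unfolding Suc[symmetric] by (rule assoc_mult_mat[OF c X T, symmetric])
  also have "\<dots> = X * T ^\<^sub>m Suc k"
    unfolding pow_mat.simps by (rule assoc_mult_mat[OF X c T])
  finally show ?case .
qed

text \<open>\<open>M\<close> stands for the value of \<open>f\<close> at \<open>T\<close>, built by
  Horner's scheme along \<open>pCons\<close>.\<close>

lemma triangular_poly_exists:
  fixes T :: "complex mat"
  assumes T: "T \<in> carrier_mat n n" "upper_triangular T"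
  shows "\<exists>M \<in> carrier_mat n n. upper_triangular M \<and> (\<forall>i<n. M $$ (i, i) = poly f (T $$ (i, i)))
    \<and> T * M = M * T \<and> (\<forall>w d. w \<in> carrier_vec n \<longrightarrow> T *\<^sub>v w = d \<cdot>\<^sub>v w \<longrightarrow> M *\<^sub>v w = poly f d \<cdot>\<^sub>v w)"
proof (induction f rule: pCons_induct)
  case 0
  show ?case using T
    by (intro bexI[of _ "0\<^sub>m n n"]) auto
next
  case (pCons a f)
  then obtain M where M: "M \<in> carrier_mat n n" "upper_triangular M"
    "\<And>i. i < n \<Longrightarrow> M $$ (i, i) = poly f (T $$ (i, i))" "T * M = M * T"
    "\<And>w d. w \<in> carrier_vec n \<Longrightarrow> T *\<^sub>v w = d \<cdot>\<^sub>v w \<Longrightarrow> M *\<^sub>v w = poly f d \<cdot>\<^sub>v w" by blast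
  define N where "N = a \<cdot>\<^sub>m 1\<^sub>m n + T * M"
  have TM: "T * M \<in> carrier_mat n n" using T M by simp
  have A1: "a \<cdot>\<^sub>m 1\<^sub>m n \<in> carrier_mat n n" by simp
  have N: "N \<in> carrier_mat n n" using TM by (simp add: N_def)
  have "upper_triangular N"
  proof (rule upper_triangularI)
    fix i j assume ij: "j < i" "i < dim_row N"
    then have "i < n" "j < n" using N by auto
    then show "N $$ (i, j) = 0"
      using T M(1) TM upper_triangularD[OF upper_triangular_mult(1)[OF T M(1,2)] ij(1)] ij
      by (simp add: N_def del: index_mult_mat(1))
  qed
  moreover have "N $$ (i, i) = poly (pCons a f) (T $$ (i, i))" if "i < n" for i
    using upper_triangular_mult(2)[OF T M(1,2) that] that T(1) M(1,3)
    by (simp add: N_def del: index_mult_mat(1))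
  moreover have "T * N = N * T"
  proof -
    have "T * N = T * (a \<cdot>\<^sub>m 1\<^sub>m n) + T * (T * M)"
      unfolding N_def by (rule mult_add_distrib_mat[OF T(1) A1 TM])
    also have "T * (a \<cdot>\<^sub>m 1\<^sub>m n) = a \<cdot>\<^sub>m 1\<^sub>m n * T"
      using T by (simp add: mult_smult_distrib[OF T(1) one_carrier_mat] mult_smult_assoc_mat[OF one_carrier_mat T(1)])
    also have "T * (T * M) = T * M * T"
      using assoc_mult_mat[OF T(1) M(1) T(1)] by (simp only: M(4)[symmetric])
    also have "a \<cdot>\<^sub>m 1\<^sub>m n * T + T * M * T = N * T"
      unfolding N_def by (rule add_mult_distrib_mat[OF A1 TM T(1), symmetric])
    finally show ?thesis .
  qed
  moreover have "N *\<^sub>v w = poly (pCons a f) d \<cdot>\<^sub>v w"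
    if w: "w \<in> carrier_vec n" "T *\<^sub>v w = d \<cdot>\<^sub>v w" for w d
  proof -
    have "(T * M) *\<^sub>v w = T *\<^sub>v (poly f d \<cdot>\<^sub>v w)"
      unfolding assoc_mult_mat_vec[OF T(1) M(1) w(1)] M(5)[OF w] ..
    also have "\<dots> = (poly f d * d) \<cdot>\<^sub>v w"
      using T w by (simp add: mult_mat_vec smult_smult_assoc)
    finally have 1: "(T * M) *\<^sub>v w = (poly f d * d) \<cdot>\<^sub>v w" .
    have "(a \<cdot>\<^sub>m 1\<^sub>m n) *\<^sub>v w = a \<cdot>\<^sub>v w"
    proof (rule eq_vecI)
      fix i assume "i < dim_vec (a \<cdot>\<^sub>v w)"
      then have i: "i < n" using w by simp
      have "((a \<cdot>\<^sub>m 1\<^sub>m n) *\<^sub>v w) $ i = (\<Sum>l<n. a * (if l = i then 1 else 0) * w $ l)"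
        using i w(1) by (simp add: scalar_prod_def atLeast0LessThan)
      also have "\<dots> = (\<Sum>l<n. if l = i then a * w $ i else 0)"
        by (intro sum.cong) auto
      finally show "((a \<cdot>\<^sub>m 1\<^sub>m n) *\<^sub>v w) $ i = (a \<cdot>\<^sub>v w) $ i"
        using i w(1) by simp
    qed (use w in simp)
    then have "N *\<^sub>v w = a \<cdot>\<^sub>v w + (poly f d * d) \<cdot>\<^sub>v w"
      unfolding N_def using add_mult_distrib_mat_vec[OF A1 TM w(1)] 1 by simp
    then show ?thesis by (auto simp: algebra_simps)
  qed
  ultimately show ?case using N by blast
qed

text \<open>Subtracting from \<open>bar T\<close> a polynomial in \<open>T\<close> that interpolates the conjugation on the
  spectrum leaves a matrix that commutes with \<open>T\<close> and annihilates all eigenvectors of \<open>T\<close>,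
  hence has no nonzero eigenvalue.\<close>

lemma trace_pow_bar_triangular:
  assumes bar: "conj_operation n bar" and T: "T \<in> carrier_mat n n" "upper_triangular T"
  shows "mat_trace (T ^\<^sub>m k * bar T) = (\<Sum>i<n. T $$ (i, i) ^ k * cnj (T $$ (i, i)))"
proof -
  have B: "bar T \<in> carrier_mat n n" "bar T * T = T * bar T"
    "\<And>u c. u \<in> carrier_vec n \<Longrightarrow> T *\<^sub>v u = c \<cdot>\<^sub>v u \<Longrightarrow> bar T *\<^sub>v u = cnj c \<cdot>\<^sub>v u"
    using bar T(1) unfolding conj_operation_def by blast+
  have "char_poly T \<noteq> 0" using degree_monic_char_poly[OF T(1)] by auto
  then have "finite {x. poly (char_poly T) x = 0}" by (rule poly_roots_finite)
  then obtain f where f: "\<And>x. poly (char_poly T) x = 0 \<Longrightarrow> poly f x = cnj x"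
    using interpolation_poly[of _ cnj] by blast
  obtain M where M: "M \<in> carrier_mat n n" "upper_triangular M"
    "\<And>i. i < n \<Longrightarrow> M $$ (i, i) = poly f (T $$ (i, i))" "T * M = M * T"
    "\<And>w d. w \<in> carrier_vec n \<Longrightarrow> T *\<^sub>v w = d \<cdot>\<^sub>v w \<Longrightarrow> M *\<^sub>v w = poly f d \<cdot>\<^sub>v w"
    using triangular_poly_exists[OF T, of f] by blast
  \<comment> \<open>Diagonal entries of a triangular matrix are roots of its characteristic
    polynomial, where \<open>f\<close> interpolates the conjugation.\<close>
  have diag: "poly f (T $$ (i, i)) = cnj (T $$ (i, i))" if "i < n" for i
  proof (rule f)
    have "T $$ (i, i) \<in> set (diag_mat T)" using that T by (auto simp: diag_mat_def)
    then show "poly (char_poly T) (T $$ (i, i)) = 0"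
      unfolding char_poly_upper_triangular[OF T] by (auto simp: poly_prod_list prod_list_zero_iff)
  qed
  define N where "N = bar T - M"
  have N: "N \<in> carrier_mat n n" unfolding N_def by (rule minus_carrier_mat[OF M(1)])
  have NT: "N * T = T * N"
    unfolding N_def using B M T
    by (simp add: minus_mult_distrib_mat[OF B(1) M(1) T(1)] mult_minus_distrib_mat[OF T(1) B(1) M(1)])
  have Tk: "T ^\<^sub>m k \<in> carrier_mat n n" using T by simp
  define X where "X = T ^\<^sub>m k * N"
  have X: "X \<in> carrier_mat n n" using Tk N by (simp add: X_def)
  have XT: "X * T = T * X"
  proof -
    have "X * T = T ^\<^sub>m k * (T * N)"
      unfolding X_def NT[symmetric] by (rule assoc_mult_mat[OF Tk N T(1)])
    also have "\<dots> = T ^\<^sub>m k * T * N" using assoc_mult_mat[OF Tk T(1) N] by simp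
    also have "T ^\<^sub>m k * T = T * T ^\<^sub>m k" by (rule pow_mat_commute[OF T(1) T(1) refl])
    also have "T * T ^\<^sub>m k * N = T * X" using assoc_mult_mat[OF T(1) Tk N] by (simp add: X_def)
    finally show ?thesis .
  qed
  have "mat_trace X = 0"
  proof (rule mat_trace_zero_spectrum[OF X])
    fix v c assume "v \<in> carrier_vec n" "v \<noteq> 0\<^sub>v n" "X *\<^sub>v v = c \<cdot>\<^sub>v v"
    \<comment> \<open>On a common eigenvector \<open>w\<close> both \<open>bar T\<close> and
      \<open>M\<close> act as multiplication by \<open>cnj d\<close>, so \<open>N\<close> and then
      \<open>X\<close> annihilate \<open>w\<close>.\<close>
    then obtain w d where w: "w \<in> carrier_vec n" "w \<noteq> 0\<^sub>v n" "X *\<^sub>v w = c \<cdot>\<^sub>v w" "T *\<^sub>v w = d \<cdot>\<^sub>v w"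
      using common_eigenvector[OF T X XT] by blast
    have "eigenvalue T d" using w T unfolding eigenvalue_def eigenvector_def by auto
    then have "poly f d = cnj d" using f eigenvalue_root_char_poly[OF T(1)] by simp
    then have "bar T *\<^sub>v w = M *\<^sub>v w" using B(3)[OF w(1,4)] M(5)[OF w(1,4)] by simp
    then have "N *\<^sub>v w = 0\<^sub>v n"
      using minus_mult_distrib_mat_vec[OF B(1) M(1) w(1)] M(1) w(1) by (simp add: N_def)
    moreover have "T ^\<^sub>m k *\<^sub>v 0\<^sub>v n = 0\<^sub>v n"
      using Tk T(1) by (intro eq_vecI) auto
    ultimately have "X *\<^sub>v w = 0\<^sub>v n"
      using assoc_mult_mat_vec[OF Tk N w(1)] by (simp add: X_def)
    then have "c \<cdot>\<^sub>v w = 0\<^sub>v n" using w(3) by simp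
    moreover obtain i where "i < n" "w $ i \<noteq> 0" using w(1,2) by (metis carrier_vecD eq_vecI index_zero_vec)
    ultimately have "c * w $ i = 0" using w(1) by (metis carrier_vecD index_smult_vec(1) index_zero_vec(1))
    then show "c = 0" using \<open>w $ i \<noteq> 0\<close> by simp
  qed
  moreover have "X = T ^\<^sub>m k * bar T - T ^\<^sub>m k * M"
    unfolding X_def N_def by (rule mult_minus_distrib_mat[OF Tk B(1) M(1)])
  ultimately have "mat_trace (T ^\<^sub>m k * bar T) = mat_trace (T ^\<^sub>m k * M)"
    using mat_trace_minus[of "T ^\<^sub>m k * bar T" n "T ^\<^sub>m k * M"] Tk B M by simp
  also have "\<dots> = (\<Sum>i<n. T $$ (i, i) ^ k * cnj (T $$ (i, i)))"
    using Tk upper_triangular_mult(2)[OF Tk upper_triangular_pow(1)[OF T] M(1,2)]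
      upper_triangular_pow(2)[OF T] M(3) diag
    by (auto simp: mat_trace_def simp del: index_mult_mat(1) intro!: sum.cong)
  finally show ?thesis .
qed

lemma conj_mult_mat:
  fixes U V X Y :: "'a :: semiring_1 mat"
  assumes U: "U \<in> carrier_mat n n" and V: "V \<in> carrier_mat n n" and VU: "V * U = 1\<^sub>m n"
    and X: "X \<in> carrier_mat n n" and Y: "Y \<in> carrier_mat n n"
  shows "U * X * V * (U * Y * V) = U * (X * Y) * V"
proof -
  have "U * X * V * (U * Y * V) = U * X * (V * U) * Y * V"
    using U V X Y by (simp add: assoc_mult_mat[of _ n n _ n _ n])
  then show ?thesis
    unfolding VU right_mult_one_mat[OF mult_carrier_mat[OF U X]] assoc_mult_mat[OF U X Y] .
qed

text \<open>Compatibility of \<open>bar\<close> with similarity reduces the trace to the triangular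
  matrix \<open>T\<close>, where \<open>trace_pow_bar_triangular\<close> applies.\<close>

lemma trace_pow_bar:
  assumes bar: "conj_operation n bar"
    and U: "U \<in> carrier_mat n n" "U * mat_adjoint U = 1\<^sub>m n" "mat_adjoint U * U = 1\<^sub>m n"
    and T: "T \<in> carrier_mat n n" "upper_triangular T"
    and A: "A = U * T * mat_adjoint U"
  shows "mat_trace (A ^\<^sub>m k * bar A) = (\<Sum>i<n. T $$ (i, i) ^ k * cnj (T $$ (i, i)))"
proof -
  define V where "V = mat_adjoint U"
  have V: "V \<in> carrier_mat n n" using U by (simp add: V_def)
  note U = U[folded V_def] and A = A[folded V_def]
  have B: "bar T \<in> carrier_mat n n" using bar T unfolding conj_operation_def by blast
  have barA: "bar A = U * bar T * V"
  proof -
    have "inverts_mat V U" "inverts_mat U V" using U V by (simp_all add: inverts_mat_def)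
    then show ?thesis using bar T(1) U(1) V unfolding A conj_operation_def by blast
  qed
  have "similar_mat_wit A T U V"
    by (rule similar_mat_witI[of _ _ n]) (use U T V A in auto)
  then have Ak: "A ^\<^sub>m k = U * T ^\<^sub>m k * V" by (rule similar_mat_wit_pow_id)
  have Tk: "T ^\<^sub>m k \<in> carrier_mat n n" using T by simp
  have "A ^\<^sub>m k * bar A = U * (T ^\<^sub>m k * bar T) * V"
    unfolding Ak barA by (rule conj_mult_mat[OF U(1) V U(3) Tk B])
  then show ?thesis
    using mat_trace_similar[of U n "T ^\<^sub>m k * bar T" V] U V Tk B trace_pow_bar_triangular[OF bar T, of k] by simp
qed

section \<open>Traces against the adjugate and Jacobi's formula\<close>

lemma poly_char_poly_det:
  fixes A :: "complex mat"
  assumes "A \<in> carrier_mat n n"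
  shows "poly (char_poly A) x = det (x \<cdot>\<^sub>m 1\<^sub>m n - A)"
  unfolding char_poly_def
  by (rule poly_det_cong[of _ n]) (use assms in \<open>auto simp: char_poly_matrix_def\<close>)

text \<open>Entries of the adjugate are, up to sign, minors of size \<open>n - 1\<close>. Evaluation
  commutes with them, and entries of degree at most 1 bound their degree.\<close>

lemma poly_adj_char_poly_matrix:
  fixes A :: "complex mat"
  assumes A: "A \<in> carrier_mat n n" and ij: "i < n" "j < n"
  shows "poly (adj_mat (char_poly_matrix A) $$ (i, j)) x = adj_mat (x \<cdot>\<^sub>m 1\<^sub>m n - A) $$ (i, j)"
    and "degree (adj_mat (char_poly_matrix A) $$ (i, j)) < n"
proof -
  let ?M = "char_poly_matrix A" and ?N = "x \<cdot>\<^sub>m 1\<^sub>m n - A"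
  have M: "?M \<in> carrier_mat n n" and N: "?N \<in> carrier_mat n n"
    using A by (auto intro: minus_carrier_mat)
  have dM: "mat_delete ?M j i \<in> carrier_mat (n - 1) (n - 1)"
    and dN: "mat_delete ?N j i \<in> carrier_mat (n - 1) (n - 1)"
    by (rule mat_delete_carrier[OF M], rule mat_delete_carrier[OF N])
  have MN: "poly (?M $$ (k, l)) x = ?N $$ (k, l)" "degree (?M $$ (k, l)) \<le> 1" if "k < n" "l < n" for k l
    using that A by (auto simp: char_poly_matrix_def)
  have "poly (det (mat_delete ?M j i)) x = det (mat_delete ?N j i)"
    by (rule poly_det_cong[OF dN dM])
      (use M N MN(1) in \<open>auto simp: mat_delete_def simp del: index_minus_mat\<close>)
  moreover have "adj_mat ?M $$ (i, j) = cofactor ?M j i" "adj_mat ?N $$ (i, j) = cofactor ?N j i"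
    using ij by (simp_all add: adj_mat_def carrier_matD[OF A] carrier_matD[OF M])
  ultimately show "poly (adj_mat ?M $$ (i, j)) x = adj_mat ?N $$ (i, j)"
    by (simp add: cofactor_def poly_power)
  have "degree (det (mat_delete ?M j i)) \<le> 1 * (n - 1)"
    by (rule degree_det_le[OF _ dM]) (use M MN(2) in \<open>auto simp: mat_delete_def\<close>)
  then have "degree (cofactor ?M j i) \<le> n - 1"
    by (auto simp: cofactor_def minus_one_power_iff)
  then show "degree (adj_mat ?M $$ (i, j)) < n"
    using ij \<open>adj_mat ?M $$ (i, j) = cofactor ?M j i\<close> by simp
qed

text \<open>A genuine polynomial in x for tr (adj (x I - A) D), so that degrees, coefficients and
  root orders can be used; \<open>poly_adj_trace_poly\<close> gives its values.\<close>

definition adj_trace_poly :: "complex mat \<Rightarrow> complex mat \<Rightarrow> complex poly" where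
  "adj_trace_poly A D = (\<Sum>i<dim_row A. \<Sum>j<dim_row A.
     smult (D $$ (j, i)) (adj_mat (char_poly_matrix A) $$ (i, j)))"

lemma poly_adj_trace_poly:
  assumes A: "A \<in> carrier_mat n n" and D: "D \<in> carrier_mat n n"
  shows "poly (adj_trace_poly A D) x = mat_trace (adj_mat (x \<cdot>\<^sub>m 1\<^sub>m n - A) * D)"
proof -
  have N: "x \<cdot>\<^sub>m 1\<^sub>m n - A \<in> carrier_mat n n" using A by (auto intro: minus_carrier_mat)
  show ?thesis
    unfolding mat_trace_mult[OF adj_mat(1)[OF N] D] adj_trace_poly_def poly_sum
    using A by (auto simp: poly_adj_char_poly_matrix(1)[OF A] mult.commute intro!: sum.cong)
qed

lemma degree_adj_trace_poly:
  assumes A: "A \<in> carrier_mat n n" and n: "n > 0"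
  shows "degree (adj_trace_poly A D) < n"
proof -
  have "degree (adj_trace_poly A D) \<le> n - 1"
    unfolding adj_trace_poly_def
  proof (intro degree_sum_le)
    fix i j assume "i \<in> {..<dim_row A}" "j \<in> {..<dim_row A}"
    then show "degree (smult (D $$ (j, i)) (adj_mat (char_poly_matrix A) $$ (i, j))) \<le> n - 1"
      using poly_adj_char_poly_matrix(2)[OF A, of i j] A
      by (intro order_trans[OF degree_smult_le]) auto
  qed auto
  then show ?thesis using n by simp
qed

text \<open>Multiplying adj (x I - A) (x I - A) = det (x I - A) I by \<open>D\<close> and taking
  traces yields a recursion that replaces \<open>D\<close> by \<open>A * D\<close>.\<close>

lemma adj_trace_poly_step:
  assumes A: "A \<in> carrier_mat n n" and D: "D \<in> carrier_mat n n"
  shows "[:0, 1:] * adj_trace_poly A D = smult (mat_trace D) (char_poly A) + adj_trace_poly A (A * D)"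
proof (rule poly_ext)
  fix x
  define M where "M = x \<cdot>\<^sub>m 1\<^sub>m n - A"
  define R where "R = adj_mat M"
  have M: "M \<in> carrier_mat n n" using A by (auto simp: M_def intro: minus_carrier_mat)
  have R: "R \<in> carrier_mat n n" "R * M = det M \<cdot>\<^sub>m 1\<^sub>m n"
    using adj_mat[OF M] by (simp_all add: R_def)
  have AD: "A * D \<in> carrier_mat n n" using A D by simp
  have xD: "x \<cdot>\<^sub>m D \<in> carrier_mat n n" using D by simp
  have "M * D = x \<cdot>\<^sub>m 1\<^sub>m n * D - A * D"
    unfolding M_def by (rule minus_mult_distrib_mat) (use A D in auto)
  also have "x \<cdot>\<^sub>m 1\<^sub>m n * D = x \<cdot>\<^sub>m D"
    using D by (simp add: mult_smult_assoc_mat[OF one_carrier_mat D])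
  finally have MD: "M * D = x \<cdot>\<^sub>m D - A * D" .
  have "R * (M * D) = x \<cdot>\<^sub>m (R * D) - R * (A * D)"
    unfolding MD mult_minus_distrib_mat[OF R(1) xD AD] mult_smult_distrib[OF R(1) D] ..
  moreover have "R * (M * D) = det M \<cdot>\<^sub>m D"
    unfolding assoc_mult_mat[OF R(1) M D, symmetric] R(2)
    using D by (simp add: mult_smult_assoc_mat[OF one_carrier_mat D])
  ultimately have "det M * mat_trace D = x * mat_trace (R * D) - mat_trace (R * (A * D))"
    using mat_trace_smult[OF D, of "det M"] mat_trace_smult[of "R * D" n x]
      mat_trace_minus[of "x \<cdot>\<^sub>m (R * D)" n "R * (A * D)"] R(1) D AD by simp
  then show "poly ([:0, 1:] * adj_trace_poly A D) x
      = poly (smult (mat_trace D) (char_poly A) + adj_trace_poly A (A * D)) x"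
    by (simp add: poly_adj_trace_poly[OF A D] poly_adj_trace_poly[OF A AD] poly_char_poly_det[OF A]
        mult.commute flip: M_def R_def)
qed

text \<open>By the recursion, the differences \<open>?r k\<close> satisfy r_k = x^k r_0. As r_n has
  degree below \<open>n\<close>, this forces r_0 = 0. Thus the abstract matrix \<open>bar A\<close>
  can be exchanged for an explicit diagonal one with the same traces.\<close>

lemma adj_trace_poly_cong:
  assumes A: "A \<in> carrier_mat n n" "D \<in> carrier_mat n n" and B: "B \<in> carrier_mat n n" "E \<in> carrier_mat n n"
    and cp: "char_poly A = char_poly B" and tr: "\<And>k. mat_trace (A ^\<^sub>m k * D) = mat_trace (B ^\<^sub>m k * E)"
    and n: "n > 0"
  shows "adj_trace_poly A D = adj_trace_poly B E"
proof -
  let ?r = "\<lambda>k. adj_trace_poly A (A ^\<^sub>m k * D) - adj_trace_poly B (B ^\<^sub>m k * E)"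
  have pow_Suc: "X * (X ^\<^sub>m k * Y) = X ^\<^sub>m Suc k * Y"
    if "X \<in> carrier_mat n n" "Y \<in> carrier_mat n n" for X Y :: "complex mat" and k
  proof -
    have Xk: "X ^\<^sub>m k \<in> carrier_mat n n" using that by simp
    show ?thesis
      unfolding pow_mat.simps pow_mat_commute[OF that(1) that(1) refl]
      by (rule assoc_mult_mat[OF that(1) Xk that(2), symmetric])
  qed
  have step: "[:0, 1:] * ?r k = ?r (Suc k)" for k
  proof -
    have "A ^\<^sub>m k * D \<in> carrier_mat n n" "B ^\<^sub>m k * E \<in> carrier_mat n n" using A B by auto
    then show ?thesis
      unfolding right_diff_distrib
      by (simp only: adj_trace_poly_step[OF A(1)] adj_trace_poly_step[OF B(1)] pow_Suc[OF A] pow_Suc[OF B] cp tr)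
         simp
  qed
  have "?r k = [:0, 1:] ^ k * ?r 0" for k
  proof (induction k)
    case (Suc k)
    show ?case unfolding step[symmetric] power_Suc mult.assoc Suc[symmetric] ..
  qed simp
  then have r: "?r n = [:0, 1:] ^ n * ?r 0" .
  have "degree (?r n) < n"
    using degree_adj_trace_poly[OF A(1) n] degree_adj_trace_poly[OF B(1) n] by (simp add: degree_diff_less)
  moreover have "degree ([:0, 1:] ^ n * ?r 0) \<ge> n" if "?r 0 \<noteq> 0"
    using that by (subst degree_mult_eq) (simp_all add: degree_power_eq)
  ultimately have "?r 0 = 0" using r by fastforce
  then show ?thesis using A B by simp
qed

text \<open>With zero trace, one use of the recursion bounds the degree. A second writes x^2 q as tr
  (A D) times the monic characteristic polynomial plus a polynomial of degree below
  \<open>n\<close>.\<close>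

lemma adj_trace_poly_traceless:
  assumes A: "A \<in> carrier_mat n n" and D: "D \<in> carrier_mat n n" and tr: "mat_trace D = 0" and n: "n \<ge> 2"
  shows "degree (adj_trace_poly A D) \<le> n - 2" "coeff (adj_trace_poly A D) (n - 2) = mat_trace (A * D)"
proof -
  let ?q = "adj_trace_poly A D"
  have AD: "A * D \<in> carrier_mat n n" and AAD: "A * (A * D) \<in> carrier_mat n n" using A D by auto
  have 1: "pCons 0 ?q = adj_trace_poly A (A * D)"
    using adj_trace_poly_step[OF A D] tr by simp
  have 2: "pCons 0 (pCons 0 ?q) = smult (mat_trace (A * D)) (char_poly A) + adj_trace_poly A (A * (A * D))"
    using adj_trace_poly_step[OF A AD] unfolding 1[symmetric] by simp
  show "degree ?q \<le> n - 2"
  proof (cases "?q = 0")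
    case False
    then show ?thesis using degree_adj_trace_poly[OF A, of "A * D"] n unfolding 1[symmetric] by simp
  qed simp
  have "coeff ?q (n - 2) = coeff (pCons 0 (pCons 0 ?q)) (Suc (Suc (n - 2)))" by simp
  also have "Suc (Suc (n - 2)) = n" using n by simp
  also have "coeff (pCons 0 (pCons 0 ?q)) n = mat_trace (A * D)"
    unfolding 2 using degree_adj_trace_poly[OF A, of "A * (A * D)"] degree_monic_char_poly[OF A] n
    by (simp add: coeff_eq_0)
  finally show "coeff ?q (n - 2) = mat_trace (A * D)" .
qed

lemma adj_trace_poly_diff:
  assumes "A \<in> carrier_mat n n" "D \<in> carrier_mat n n" "E \<in> carrier_mat n n"
  shows "adj_trace_poly A (D - E) = adj_trace_poly A D - adj_trace_poly A E"
  using assms by (auto simp: adj_trace_poly_def smult_diff_left simp flip: sum_subtractf intro!: sum.cong)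

section \<open>Derivative of the determinant along a line\<close>

lemma DERIV_prod_one_plus:
  fixes a :: "'b \<Rightarrow> complex"
  assumes "finite S"
  shows "((\<lambda>v. \<Prod>i\<in>S. 1 + v * a i) has_field_derivative (\<Sum>i\<in>S. a i)) (at 0)"
  using assms
proof (induction S)
  case (insert i S)
  then show ?case by (auto intro!: derivative_eq_intros)
qed simp

text \<open>Triangularising \<open>X\<close> turns the determinant into the product of the factors 1
  + v T_ii, whose derivative at 0 is the sum of the T_ii.\<close>

lemma DERIV_det_one_plus:
  assumes X: "X \<in> carrier_mat n n"
  shows "((\<lambda>v. det (1\<^sub>m n + v \<cdot>\<^sub>m X)) has_field_derivative mat_trace X) (at 0)"
proof -
  obtain es where es: "char_poly X = (\<Prod>e\<leftarrow>es. [:- e, 1:])"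
    using char_poly_factorized[OF X] by blast
  obtain T P Q where S: "triangular_similarity n es X T P Q"
    using triangular_similarity_exists[OF X es] by blast
  then have T: "T \<in> carrier_mat n n" "upper_triangular T" and P: "P \<in> carrier_mat n n"
    and Q: "Q \<in> carrier_mat n n" and PQ: "P * Q = 1\<^sub>m n" "Q * P = 1\<^sub>m n" and X': "X = P * T * Q"
    by (auto simp: triangular_similarity_def)
  have "det (1\<^sub>m n + v \<cdot>\<^sub>m X) = (\<Prod>i<n. 1 + v * T $$ (i, i))" for v
  proof -
    define Y where "Y = 1\<^sub>m n + v \<cdot>\<^sub>m T"
    have Y: "Y \<in> carrier_mat n n" "upper_triangular Y"
      using T by (auto simp: Y_def intro!: upper_triangularI dest: upper_triangularD)
    have vT: "v \<cdot>\<^sub>m T \<in> carrier_mat n n" using T by simp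
    have "P * Y * Q = (P + P * (v \<cdot>\<^sub>m T)) * Q"
      unfolding Y_def mult_add_distrib_mat[OF P one_carrier_mat vT] using P by simp
    also have "\<dots> = P * Q + P * (v \<cdot>\<^sub>m T) * Q"
      by (rule add_mult_distrib_mat) (use P T Q in auto)
    also have "P * (v \<cdot>\<^sub>m T) * Q = v \<cdot>\<^sub>m X"
      unfolding X' mult_smult_distrib[OF P T(1)] by (rule mult_smult_assoc_mat[of _ n n]) (use P T Q in auto)
    finally have "1\<^sub>m n + v \<cdot>\<^sub>m X = P * Y * Q" by (simp add: PQ)
    then have "similar_mat (1\<^sub>m n + v \<cdot>\<^sub>m X) Y"
      using P Q PQ Y X by (intro similar_matI[of _ _ P Q n]) auto
    then have "det (1\<^sub>m n + v \<cdot>\<^sub>m X) = det Y" by (rule det_similar)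
    also have "\<dots> = (\<Prod>i<n. Y $$ (i, i))"
      using det_upper_triangular[OF Y(2,1)] Y(1) by (simp add: diag_mat_def prod.list_conv_set_nth atLeast0LessThan)
    also have "\<dots> = (\<Prod>i<n. 1 + v * T $$ (i, i))"
      using T by (auto simp: Y_def)
    finally show ?thesis .
  qed
  moreover have "mat_trace X = (\<Sum>i<n. T $$ (i, i))"
    using mat_trace_similar[OF P T(1) Q PQ(2)] T X' by (simp add: mat_trace_def)
  ultimately show ?thesis using DERIV_prod_one_plus[of "{..<n}" "\<lambda>i. T $$ (i, i)"] by simp
qed

text \<open>Jacobi's formula at an invertible matrix: factoring out \<open>M\<close> leaves det (1 +
  v X) with X = adj M N / det M.\<close>

lemma DERIV_det:
  assumes M: "M \<in> carrier_mat n n" and N: "N \<in> carrier_mat n n" and inv: "det M \<noteq> 0"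
  shows "((\<lambda>v. det (M + v \<cdot>\<^sub>m N)) has_field_derivative mat_trace (adj_mat M * N)) (at 0)"
proof -
  define Y where "Y = adj_mat M * N"
  have Y: "Y \<in> carrier_mat n n" using adj_mat(1)[OF M] N by (simp add: Y_def)
  have MY: "M * Y = det M \<cdot>\<^sub>m N"
    unfolding Y_def assoc_mult_mat[OF M adj_mat(1)[OF M] N, symmetric] adj_mat(2)[OF M]
    using N by (simp add: mult_smult_assoc_mat[OF one_carrier_mat N])
  define X where "X = (1 / det M) \<cdot>\<^sub>m Y"
  have X: "X \<in> carrier_mat n n" using Y by (simp add: X_def)
  have "det (M + v \<cdot>\<^sub>m N) = det M * det (1\<^sub>m n + v \<cdot>\<^sub>m X)" for v
  proof -
    have vX: "v \<cdot>\<^sub>m X \<in> carrier_mat n n" using X by simp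
    have "M * (1\<^sub>m n + v \<cdot>\<^sub>m X) = M + v \<cdot>\<^sub>m (M * X)"
      unfolding mult_add_distrib_mat[OF M one_carrier_mat vX] mult_smult_distrib[OF M X] using M by simp
    also have "M * X = N"
      unfolding X_def mult_smult_distrib[OF M Y] MY using inv N by (auto intro!: eq_matI)
    finally show ?thesis
      using det_mult[OF M, of "1\<^sub>m n + v \<cdot>\<^sub>m X"] vX by simp
  qed
  moreover have "det M * mat_trace X = mat_trace Y"
    using inv mat_trace_smult[OF Y] by (simp add: X_def)
  ultimately show ?thesis
    using DERIV_cmult[OF DERIV_det_one_plus[OF X], of "det M"] by (simp add: Y_def)
qed

section \<open>The determinant of the pedal matrix\<close>

lemma det_conj_unitary:
  assumes U: "U \<in> carrier_mat n n" "U * V = 1\<^sub>m n" and V: "V \<in> carrier_mat n n" "V * U = 1\<^sub>m n"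
    and T: "T \<in> carrier_mat n n" "S \<in> carrier_mat n n"
  shows "det (p \<cdot>\<^sub>m 1\<^sub>m n + u \<cdot>\<^sub>m (U * T * V) + v \<cdot>\<^sub>m (U * S * V)) = det (p \<cdot>\<^sub>m 1\<^sub>m n + u \<cdot>\<^sub>m T + v \<cdot>\<^sub>m (S :: complex mat))"
proof (rule det_similar, rule similar_matI)
  have pI: "p \<cdot>\<^sub>m 1\<^sub>m n \<in> carrier_mat n n" and uT: "u \<cdot>\<^sub>m T \<in> carrier_mat n n" and vS: "v \<cdot>\<^sub>m S \<in> carrier_mat n n"
    using T by auto
  have "U * (p \<cdot>\<^sub>m 1\<^sub>m n + u \<cdot>\<^sub>m T + v \<cdot>\<^sub>m S) * V
      = (U * (p \<cdot>\<^sub>m 1\<^sub>m n) + U * (u \<cdot>\<^sub>m T) + U * (v \<cdot>\<^sub>m S)) * V"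
    by (subst mult_add_distrib_mat[OF U(1) _ vS], use pI uT in simp)
       (subst mult_add_distrib_mat[OF U(1) pI uT], rule refl)
  also have "\<dots> = U * (p \<cdot>\<^sub>m 1\<^sub>m n) * V + U * (u \<cdot>\<^sub>m T) * V + U * (v \<cdot>\<^sub>m S) * V"
    using U V T pI uT vS
    by (subst add_mult_distrib_mat[of _ n n], simp, simp, simp)
       (subst add_mult_distrib_mat[of _ n n], simp_all)
  also have "U * (p \<cdot>\<^sub>m 1\<^sub>m n) * V = p \<cdot>\<^sub>m 1\<^sub>m n"
    unfolding mult_smult_distrib[OF U(1) one_carrier_mat] right_mult_one_mat[OF U(1)]
      mult_smult_assoc_mat[OF U(1) V(1)] U(2) ..
  also have "U * (u \<cdot>\<^sub>m T) * V = u \<cdot>\<^sub>m (U * T * V)"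
    unfolding mult_smult_distrib[OF U(1) T(1)] by (rule mult_smult_assoc_mat[of _ n n]) (use U V T in auto)
  also have "U * (v \<cdot>\<^sub>m S) * V = v \<cdot>\<^sub>m (U * S * V)"
    unfolding mult_smult_distrib[OF U(1) T(2)] by (rule mult_smult_assoc_mat[of _ n n]) (use U V T in auto)
  finally show "p \<cdot>\<^sub>m 1\<^sub>m n + u \<cdot>\<^sub>m (U * T * V) + v \<cdot>\<^sub>m (U * S * V)
      = U * (p \<cdot>\<^sub>m 1\<^sub>m n + u \<cdot>\<^sub>m T + v \<cdot>\<^sub>m S) * V" ..
qed (use U V T in auto)

lemma det_triangular_pencil:
  fixes T E :: "complex mat"
  assumes T: "T \<in> carrier_mat n n" "upper_triangular T" and E: "E \<in> carrier_mat n n" "upper_triangular E"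
  shows "det (p \<cdot>\<^sub>m 1\<^sub>m n + u \<cdot>\<^sub>m T + v \<cdot>\<^sub>m E) = (\<Prod>i<n. p + u * T $$ (i, i) + v * E $$ (i, i))"
proof -
  let ?Y = "p \<cdot>\<^sub>m 1\<^sub>m n + u \<cdot>\<^sub>m T + v \<cdot>\<^sub>m E"
  have Y: "?Y \<in> carrier_mat n n" "upper_triangular ?Y"
    using T E upper_triangularD[OF T(2)] upper_triangularD[OF E(2)] by (auto intro!: upper_triangularI)
  have "det ?Y = (\<Prod>i<n. ?Y $$ (i, i))"
    using det_upper_triangular[OF Y(2,1)] E(1) by (simp add: diag_mat_def prod.list_conv_set_nth atLeast0LessThan)
  also have "\<dots> = (\<Prod>i<n. p + u * T $$ (i, i) + v * E $$ (i, i))"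
    using T E by (intro prod.cong) auto
  finally show ?thesis .
qed

lemma det_mat_adjoint:
  fixes A :: "complex mat"
  assumes A: "A \<in> carrier_mat n n"
  shows "det (mat_adjoint A) = cnj (det A)"
proof -
  interpret comm_ring_hom cnj by standard auto
  have "mat_adjoint A = transpose_mat (map_mat cnj A)"
    using A by (intro eq_matI) auto
  then show ?thesis using det_transpose[of "map_mat cnj A" n] A by simp
qed

text \<open>The adjoint of the pencil at p, u, v is the pencil at the conjugates with
  \<open>u\<close> and \<open>v\<close> exchanged, and taking adjoints conjugates the
  determinant.\<close>

lemma hermitian_form_det:
  assumes A: "A \<in> carrier_mat n n"
  shows "hermitian_form (\<lambda>p u v. det (p \<cdot>\<^sub>m 1\<^sub>m n + u \<cdot>\<^sub>m A + v \<cdot>\<^sub>m mat_adjoint A))"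
  unfolding hermitian_form_def
proof (intro allI)
  fix p u v
  have H: "mat_adjoint A \<in> carrier_mat n n" using A by simp
  let ?M = "p \<cdot>\<^sub>m 1\<^sub>m n + u \<cdot>\<^sub>m A + v \<cdot>\<^sub>m mat_adjoint A"
  have M: "?M \<in> carrier_mat n n" using A H by simp
  have "cnj p \<cdot>\<^sub>m 1\<^sub>m n + cnj v \<cdot>\<^sub>m A + cnj u \<cdot>\<^sub>m mat_adjoint A = mat_adjoint ?M"
    using A H M by (intro eq_matI) (auto simp: mat_adjoint_index[OF M] mat_adjoint_index[OF A])
  then show "det (cnj p \<cdot>\<^sub>m 1\<^sub>m n + cnj v \<cdot>\<^sub>m A + cnj u \<cdot>\<^sub>m mat_adjoint A) = cnj (det ?M)"
    using det_mat_adjoint[OF M] by simp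
qed

section \<open>Substituting the pedal parameters\<close>

lemma pedal_mat_pencil:
  fixes p \<theta> :: real
  assumes A: "A \<in> carrier_mat n n"
  defines "u \<equiv> cis (- \<theta>) / (2 * \<i>)"
  shows "pedal_mat p \<theta> A = of_real p \<cdot>\<^sub>m 1\<^sub>m n + u \<cdot>\<^sub>m A + cnj u \<cdot>\<^sub>m mat_adjoint A"
proof -
  define c s where "c = complex_of_real (cos \<theta>)" and "s = complex_of_real (sin \<theta>)"
  have u: "u = (c - \<i> * s) / (2 * \<i>)" "cnj u = - (c + \<i> * s) / (2 * \<i>)"
    by (simp_all add: u_def c_def s_def complex_eq_iff)
  \<comment> \<open>Here \<open>a\<close> and \<open>b\<close> stand for entries of \<open>A\<close>
    and of its adjoint; their coefficients are c/(2i) - s/2 = u and -c/(2i) - s/2 = cnj u.\<close>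
  have "c * (1 / (2 * \<i>)) * (a - b) - s * (1 / 2) * (a + b) = u * a + cnj u * b" for a b :: complex
    unfolding u(2) unfolding u(1) by (simp add: field_simps)
  then have "of_real p * e + c * (1 / (2 * \<i>) * (a - b)) - s * (1 / 2 * (a + b))
    = of_real p * e + u * a + cnj u * b" for a b e :: complex
    by (metis add.assoc add_diff_eq mult.assoc)
  then show ?thesis using A
    by (intro eq_matI) (auto simp: pedal_mat_def mat_Im_def mat_Re_def simp flip: c_def s_def)
qed

lemma pole_form_pedal:
  defines "u \<equiv> \<lambda>\<theta>::real. cis (- \<theta>) / (2 * \<i>)"
  shows "pole_form P (of_real p) (u \<theta>) (cnj (u \<theta>)) = of_real (pole_pedal p \<theta> P)"
    and "u \<theta> * cnj (u \<theta>) = 1 / 4"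
proof -
  \<comment> \<open>A number plus its conjugate is twice its real part; the division by 2i in
    \<open>u\<close> turns this into an imaginary part.\<close>
  have *: "u \<theta> * a + cnj (u \<theta> * a) = of_real (Im (cis (- \<theta>) * a))" for a
    by (simp add: u_def complex_eq_iff) (simp add: field_simps)
  show "pole_form P (of_real p) (u \<theta>) (cnj (u \<theta>)) = of_real (pole_pedal p \<theta> P)"
    using * by (cases P) (simp_all add: pedal_def pole_pedal_infinite(2) add.assoc del: pole_pedal.simps(2))
  show "u \<theta> * cnj (u \<theta>) = 1 / 4"
    unfolding u_def complex_norm_square[symmetric] by (simp add: norm_divide norm_mult power_divide)
qed

text \<open>For v = cnj u the product \<open>u v\<close> is 1/4, which produces the powers of 4.
  Poles are numbered from 1, list positions from 0.\<close>

lemma hermitian_form_pedal: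
  assumes F: "hom_form m F" "hermitian_form F"
  defines "u \<equiv> \<lambda>\<theta>::real. cis (- \<theta>) / (2 * \<i>)"
  shows "\<exists>(\<gamma> :: nat \<Rightarrow> real) \<mu>. \<forall>p \<theta> :: real. F (of_real p) (u \<theta>) (cnj (u \<theta>)) =
    of_real (\<Sum>k\<le>m div 2. \<gamma> k / 4 ^ k * (\<Prod>j=1..m - 2 * k. pole_pedal p \<theta> (\<mu> k j)))"
proof -
  obtain \<gamma> ps where ps: "\<And>k. k \<le> m div 2 \<Longrightarrow> length (ps k) = m - 2 * k"
    "\<And>p u v. F p u v = (\<Sum>k\<le>m div 2. of_real (\<gamma> k) * (u * v) ^ k * (\<Prod>P\<leftarrow>ps k. pole_form P p u v))"
    using hermitian_form_expansion[OF F] by blast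
  show ?thesis
  proof (intro exI[of _ \<gamma>] exI[of _ "\<lambda>k j. ps k ! (j - 1)"] allI)
    fix p \<theta> :: real
    have uu: "u \<theta> * cnj (u \<theta>) = 1 / 4"
      unfolding u_def by (rule pole_form_pedal(2))
    have "(\<Prod>P\<leftarrow>ps k. pole_form P (of_real p) (u \<theta>) (cnj (u \<theta>)))
        = of_real (\<Prod>j=1..m - 2 * k. pole_pedal p \<theta> (ps k ! (j - 1)))" if "k \<le> m div 2" for k
      using ps(1)[OF that] pole_form_pedal(1)
      by (simp add: u_def prod.list_conv_set_nth atLeast0LessThan prod.atLeast1_atMost_eq)
    then show "F (of_real p) (u \<theta>) (cnj (u \<theta>)) =
        of_real (\<Sum>k\<le>m div 2. \<gamma> k / 4 ^ k * (\<Prod>j=1..m - 2 * k. pole_pedal p \<theta> (ps k ! (j - 1))))"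
      unfolding ps(2) uu by (auto simp: power_divide intro!: sum.cong)
  qed
qed

lemma order_prod_linear_factors:
  "order (z :: complex) (\<Prod>a\<leftarrow>as. [:- a, 1:]) = card {j \<in> {1..length as}. as ! (j - 1) = z}"
proof -
  have "order z (\<Prod>a\<leftarrow>as. [:- a, 1:]) = length (filter ((=) z) as)"
  proof (induction as)
    case (Cons a as)
    have "(\<Prod>a\<leftarrow>a # as. [:- a, 1:]) \<noteq> 0" unfolding prod_list_zero_iff by auto
    then have "order z (\<Prod>a\<leftarrow>a # as. [:- a, 1:]) = order z [:- a, 1:] + order z (\<Prod>a\<leftarrow>as. [:- a, 1:])"
      unfolding list.map prod_list.Cons by (rule order_mult)
    moreover have "order z [:- a, 1:] = (if z = a then 1 else 0)"
      using order_power_n_n[of a 1] by (auto intro: order_0I)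
    ultimately show ?case using Cons by simp
  qed simp
  also have "\<dots> = card {i. i < length as \<and> z = as ! i}" by (rule length_filter_conv_card)
  also have "\<dots> = card {j \<in> {1..length as}. as ! (j - 1) = z}"
    by (rule bij_betw_same_card[of Suc], rule bij_betw_byWitness[where f' = "\<lambda>j. j - 1"]) auto
  finally show ?thesis .
qed

text \<open>The trace of \<open>T\<close> times its adjoint is the sum of the squared moduli of all
  entries, so equality with the diagonal part leaves nothing off the diagonal.\<close>

lemma trace_gram_upper_triangular_diagonal:
  assumes T: "T \<in> carrier_mat n n" and eq: "mat_trace (T * mat_adjoint T) = (\<Sum>i<n. T $$ (i, i) * cnj (T $$ (i, i)))"
    and ij: "i < n" "j < n" "i \<noteq> j"
  shows "T $$ (i, j) = 0"
proof -
  define f where "f i j = (cmod (T $$ (i, j)))\<^sup>2" for i j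
  have "mat_trace (T * mat_adjoint T) = of_real (\<Sum>i<n. \<Sum>j<n. f i j)"
    unfolding mat_trace_mult[OF T mat_adjoint_carrier[OF T]] of_real_sum
    using T by (intro sum.cong refl) (simp add: f_def complex_norm_square mult.commute del: of_real_power)
  moreover have "(\<Sum>i<n. T $$ (i, i) * cnj (T $$ (i, i))) = of_real (\<Sum>i<n. f i i)"
    unfolding of_real_sum by (intro sum.cong refl) (simp add: f_def complex_norm_square mult.commute del: of_real_power)
  ultimately have "(\<Sum>i<n. \<Sum>j<n. f i j) = (\<Sum>i<n. f i i)"
    using eq by (simp only: of_real_eq_iff)
  then have "(\<Sum>i<n. (\<Sum>j<n. f i j) - f i i) = 0" by (simp add: sum_subtractf)
  moreover have d: "(\<Sum>j<n. f i j) - f i i = (\<Sum>j\<in>{..<n} - {i}. f i j)" if "i < n" for i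
    using that by (simp add: sum_diff1)
  ultimately have "(\<Sum>i<n. \<Sum>j\<in>{..<n} - {i}. f i j) = 0" by simp
  then have "(\<Sum>j\<in>{..<n} - {i}. f i j) = 0"
    using ij(1) by (subst (asm) sum_nonneg_eq_0_iff) (auto simp: f_def intro: sum_nonneg)
  then have "f i j = 0"
    using ij by (subst (asm) sum_nonneg_eq_0_iff) (auto simp: f_def)
  then show ?thesis by (simp add: f_def)
qed

theorem theorem48:
  fixes n :: nat and A :: "complex mat" and ev :: "nat \<Rightarrow> complex"
    and bar :: "complex mat \<Rightarrow> complex mat"
  assumes "n \<ge> 2" and "A \<in> carrier_mat n n"
    and "char_poly A = (\<Prod>j=1..n. [:- ev j, 1:])"
    and "conj_operation n bar"
  shows "\<exists>(\<gamma> :: nat \<Rightarrow> real) (ev2 :: nat \<Rightarrow> complex) (\<mu> :: nat \<Rightarrow> nat \<Rightarrow> pole).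
    (\<forall>p \<theta> :: real.
       det (pedal_mat p \<theta> A) =
         complex_of_real (\<Prod>j=1..n. pedal p \<theta> (ev j))
         - t_coeff bar 1 A / 4 * complex_of_real (\<Prod>j=1..n-2. pedal p \<theta> (ev2 j))
         + complex_of_real (\<Sum>k=2..n div 2.
             \<gamma> k / 4 ^ k * (\<Prod>j=1..n-2*k. pole_pedal p \<theta> (\<mu> (k + 1) j)))) \<and>
    (t_coeff bar 1 A \<noteq> 0 \<longrightarrow>
       (\<exists>q :: complex poly. q \<noteq> 0 \<and>
          (\<forall>x. poly q x =
             mat_trace (adj_mat (x \<cdot>\<^sub>m 1\<^sub>m n - A) * (mat_adjoint A - bar A))) \<and>
          (\<forall>z. order z q = card {j \<in> {1..n-2}. ev2 j = z})))"
proof -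
  note n = assms(1) and A = assms(2) and cp = assms(3) and bar = assms(4)
  define t where "t = t_coeff bar 1 A"
  define V where "V = mat_adjoint A"
  have V: "V \<in> carrier_mat n n" using A by (simp add: V_def)
  have B: "bar A \<in> carrier_mat n n" using bar A by (auto simp: conj_operation_def)
  define D where "D = V - bar A"
  have D: "D \<in> carrier_mat n n" unfolding D_def by (rule minus_carrier_mat[OF B])
  define u where "u \<theta> = cis (- \<theta>) / (2 * \<i>)" for \<theta> :: real
  have uu: "u \<theta> * cnj (u \<theta>) = 1 / 4" for \<theta> unfolding u_def by (rule pole_form_pedal(2))
  have pole: "pole_form P (of_real p) (u \<theta>) (cnj (u \<theta>)) = of_real (pole_pedal p \<theta> P)" for P p \<theta>
    unfolding u_def by (rule pole_form_pedal(1))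
  define es where "es = map (\<lambda>i. ev (Suc i)) [0..<n]"
  have prod_es: "(\<Prod>x\<leftarrow>es. g x) = (\<Prod>j=1..n. g (ev j))" for g :: "complex \<Rightarrow> 'b :: comm_monoid_mult"
    by (simp add: es_def prod.list_conv_set_nth atLeast0LessThan prod.atLeast1_atMost_eq)
  have cp_es: "char_poly A = (\<Prod>e\<leftarrow>es. [:- e, 1:])" unfolding prod_es by (rule cp)
  obtain U T where U: "U \<in> carrier_mat n n" "U * mat_adjoint U = 1\<^sub>m n" "mat_adjoint U * U = 1\<^sub>m n"
    and T: "T \<in> carrier_mat n n" "upper_triangular T" and AU: "A = U * T * mat_adjoint U"
    and diag: "\<And>i. i < n \<Longrightarrow> T $$ (i, i) = es ! i"
    using unitary_schur[OF A cp_es] by blast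
  have W: "mat_adjoint U \<in> carrier_mat n n" and Th: "mat_adjoint T \<in> carrier_mat n n" using U T by auto
  have diag_ev: "T $$ (i, i) = ev (Suc i)" if "i < n" for i using diag[OF that] that by (simp add: es_def)
  have VU: "V = U * mat_adjoint T * mat_adjoint U"
    unfolding V_def AU mat_adjoint_mult[OF mult_carrier_mat[OF U(1) T(1)] W] mat_adjoint_mult[OF U(1) T(1)]
      mat_adjoint_adjoint[OF U(1)]
    by (rule assoc_mult_mat[OF U(1) Th W, symmetric])
  note tr_bar = trace_pow_bar[OF bar U T AU]

  \<comment> \<open>\<open>E\<close> plays two roles: the pencil of \<open>T\<close> and
    \<open>E\<close> has the product over the eigenvalues as its determinant, and the traces of T^k
    E agree with those of A^k times \<open>bar A\<close>.\<close>
  define E where "E = mat n n (\<lambda>(i, j). if i = j then cnj (T $$ (i, i)) else 0)"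
  have E: "E \<in> carrier_mat n n" "upper_triangular E" by (auto simp: E_def intro!: upper_triangularI)
  have det_E: "det (p \<cdot>\<^sub>m 1\<^sub>m n + u \<cdot>\<^sub>m T + v \<cdot>\<^sub>m E) = (\<Prod>P\<leftarrow>map Finite_Pole es. pole_form P p u v)" for p u v
  proof -
    have "det (p \<cdot>\<^sub>m 1\<^sub>m n + u \<cdot>\<^sub>m T + v \<cdot>\<^sub>m E) = (\<Prod>i<n. p + u * es ! i + v * cnj (es ! i))"
      unfolding det_triangular_pencil[OF T E] by (intro prod.cong) (auto simp: E_def diag)
    then show ?thesis
      by (simp add: es_def prod.list_conv_set_nth atLeast0LessThan)
  qed
  have len: "length (map Finite_Pole es) = n" by (simp add: es_def)

  define F where "F p u v = det (p \<cdot>\<^sub>m 1\<^sub>m n + u \<cdot>\<^sub>m A + v \<cdot>\<^sub>m V)" for p u v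
  have F: "hom_form n F" "hermitian_form F"
    unfolding F_def[abs_def] V_def by (rule hom_form_det[OF A mat_adjoint_carrier[OF A]], rule hermitian_form_det[OF A])
  have pedal_F: "det (pedal_mat p \<theta> A) = F (of_real p) (u \<theta>) (cnj (u \<theta>))" for p \<theta>
    unfolding F_def V_def u_def by (rule arg_cong[OF pedal_mat_pencil[OF A]])
  define G where "G p u v = of_real 1 * (\<Prod>P\<leftarrow>map Finite_Pole es. pole_form P p u v)" for p u v
  have G: "hom_form n G" "hermitian_form G"
    using hermitian_prod_poles[where ps = "map Finite_Pole es" and c = 1] unfolding G_def[abs_def] len by auto
  have pedal_G: "G (of_real p) (u \<theta>) (cnj (u \<theta>)) = of_real (\<Prod>j=1..n. pedal p \<theta> (ev j))" for p \<theta>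
  proof -
    have "G (of_real p) (u \<theta>) (cnj (u \<theta>)) = (\<Prod>x\<leftarrow>es. of_real (pole_pedal p \<theta> (Finite_Pole x)))"
      unfolding G_def by (simp only: map_map o_def pole of_real_1 mult_1)
    then show ?thesis unfolding prod_es by simp
  qed
  have pencil_minus: "x \<cdot>\<^sub>m 1\<^sub>m n + (-1) \<cdot>\<^sub>m X = x \<cdot>\<^sub>m 1\<^sub>m n - X" if "X \<in> carrier_mat n n" for x and X :: "complex mat"
    using that by (intro eq_matI) auto
  have zero_smult: "M + 0 \<cdot>\<^sub>m X = M" if "M \<in> carrier_mat n n" "X \<in> carrier_mat n n" for M X :: "complex mat"
    using that by (intro eq_matI) auto
  have FG: "F x (-1) 0 = G x (-1) 0" for x
  proof -
    have "F x (-1) 0 = det (x \<cdot>\<^sub>m 1\<^sub>m n - A)"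
      unfolding F_def pencil_minus[OF A] by (subst zero_smult) (use A V in \<open>auto intro: minus_carrier_mat\<close>)
    also have "\<dots> = G x (-1) 0"
      unfolding poly_char_poly_det[OF A, symmetric] cp_es prod_linear_factors_poles by (simp add: G_def)
    finally show ?thesis .
  qed
  obtain F1 where F1: "hom_form (n - 2) F1" "hermitian_form F1"
    "\<And>p u v. F p u v = G p u v + u * v * F1 p u v"
    using hermitian_form_split[OF F G FG] by blast

  define q where "q = adj_trace_poly A D"
  have pq: "poly q x = mat_trace (adj_mat (x \<cdot>\<^sub>m 1\<^sub>m n - A) * D)" for x
    unfolding q_def by (rule poly_adj_trace_poly[OF A D])
  \<comment> \<open>This is the case k = 0 of the trace formula: both traces are the sum of the
    conjugated eigenvalues.\<close>
  have "mat_trace D = 0"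
  proof -
    have "mat_trace V = (\<Sum>i<n. cnj (T $$ (i, i)))"
      using mat_trace_similar[OF U(1) Th W U(3)] T by (simp add: VU mat_trace_def)
    moreover have "mat_trace (bar A) = (\<Sum>i<n. cnj (T $$ (i, i)))"
      using tr_bar[of 0] A B by simp
    ultimately show ?thesis using mat_trace_minus[OF V B] by (simp add: D_def)
  qed
  then have q: "degree q \<le> n - 2" "coeff q (n - 2) = mat_trace (A * D)"
    unfolding q_def using adj_trace_poly_traceless[OF A D _ n] by auto
  have AD: "mat_trace (A * D) = t"
    using A by (simp add: t_def t_coeff_def D_def V_def)

  \<comment> \<open>The two summands are the derivatives in \<open>v\<close>, at
    \<open>v = 0\<close> and \<open>u = -1\<close>, of the determinants defining \<open>F\<close>
    and \<open>G\<close>.\<close>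
  have q_split: "q = adj_trace_poly A V - adj_trace_poly T E"
  proof -
    have "mat_trace (A ^\<^sub>m k * bar A) = mat_trace (T ^\<^sub>m k * E)" for k
    proof -
      have Tk: "T ^\<^sub>m k \<in> carrier_mat n n" using T by simp
      show ?thesis
        unfolding tr_bar unfolding mat_trace_def
      proof (rule sum.cong)
        fix i assume "i \<in> {..<dim_row (T ^\<^sub>m k * E)}"
        then have i: "i < n" using T by simp
        show "T $$ (i, i) ^ k * cnj (T $$ (i, i)) = (T ^\<^sub>m k * E) $$ (i, i)"
          unfolding upper_triangular_mult(2)[OF Tk upper_triangular_pow(1)[OF T] E i]
            upper_triangular_pow(2)[OF T i] using i by (simp add: E_def)
      qed (use T in simp)
    qed
    moreover have "char_poly A = char_poly T"
      by (rule char_poly_similar, rule similar_matI[OF _ U(2,3) AU]) (use A T U W in blast)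
    ultimately have "adj_trace_poly A (bar A) = adj_trace_poly T E"
      using n by (intro adj_trace_poly_cong[OF A B T(1) E(1)]) auto
    then show ?thesis unfolding q_def D_def adj_trace_poly_diff[OF A V B] by simp
  qed
  have "F1 x (-1) 0 = - poly q x" if x: "poly (char_poly A) x \<noteq> 0" for x
  proof -
    obtain g where g: "\<And>v. F1 x (-1) v = poly g v" using hom_form_poly_third[OF F1(1)] by blast
    have xA: "x \<cdot>\<^sub>m 1\<^sub>m n - A \<in> carrier_mat n n" and xT: "x \<cdot>\<^sub>m 1\<^sub>m n - T \<in> carrier_mat n n"
      by (rule minus_carrier_mat[OF A], rule minus_carrier_mat[OF T(1)])
    have dA: "det (x \<cdot>\<^sub>m 1\<^sub>m n - A) \<noteq> 0" using x by (simp add: poly_char_poly_det[OF A])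
    have dT: "det (x \<cdot>\<^sub>m 1\<^sub>m n - T) \<noteq> 0"
    proof -
      have "det (x \<cdot>\<^sub>m 1\<^sub>m n - T) = G x (-1) 0"
        using det_E[of x "-1" 0] unfolding pencil_minus[OF T(1)] zero_smult[OF xT E(1)] by (simp add: G_def)
      also have "\<dots> = det (x \<cdot>\<^sub>m 1\<^sub>m n - A)"
        unfolding FG[symmetric] F_def pencil_minus[OF A] zero_smult[OF xA V] ..
      finally show ?thesis using dA by simp
    qed
    \<comment> \<open>At \<open>u = -1\<close> the difference of \<open>F\<close> and
      \<open>G\<close> is -v times \<open>F1\<close>, so its derivative at \<open>v = 0\<close>,
      computed in two ways, compares \<open>q\<close> with \<open>F1\<close>.\<close>
    have "((\<lambda>v. F x (-1) v - G x (-1) v) has_field_derivative poly q x) (at 0)"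
    proof -
      have "(F x (-1) has_field_derivative poly (adj_trace_poly A V) x) (at 0)"
        unfolding F_def[abs_def] pencil_minus[OF A] poly_adj_trace_poly[OF A V] by (rule DERIV_det[OF xA V dA])
      moreover have "(G x (-1) has_field_derivative poly (adj_trace_poly T E) x) (at 0)"
        using DERIV_det[OF xT E(1) dT]
        unfolding poly_adj_trace_poly[OF T(1) E(1)] pencil_minus[OF T(1), symmetric] det_E by (simp add: G_def[abs_def])
      ultimately show ?thesis unfolding q_split by (auto intro!: derivative_eq_intros)
    qed
    moreover have "(\<lambda>v. F x (-1) v - G x (-1) v) = poly (- [:0, 1:] * g)"
      unfolding F1(3) by (simp add: g fun_eq_iff)
    moreover have "(poly (- [:0, 1:] * g) has_field_derivative - poly g 0) (at 0)"
    proof -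
      have "poly (pderiv (- [:0, 1:] * g)) 0 = - poly g 0"
        by (simp add: pderiv_mult pderiv_pCons pderiv_minus)
      then show ?thesis using poly_DERIV[of "- [:0, 1:] * g" 0] by (simp only:)
    qed
    ultimately have "poly q x = - poly g 0" using DERIV_unique by fastforce
    then show ?thesis using g[of 0] by simp
  qed
  moreover obtain f where f: "degree f \<le> n - 2"
      "\<forall>p u. F1 p u 0 = (\<Sum>i\<le>n - 2. coeff f i * p ^ i * (- u) ^ (n - 2 - i))"
    using hom_form_restrict[OF F1(1)] by blast
  note F1f = restrict_at_minus_one[where F = F1, OF f]
  \<comment> \<open>The derivative argument covers only x outside the spectrum. Multiplication by
    the characteristic polynomial gives an identity for all x, and this nonzero factor is then
    cancelled.\<close>
  ultimately have "poly (char_poly A * (f + q)) x = 0" for x by (cases "poly (char_poly A) x = 0") auto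
  then have "char_poly A * (f + q) = 0" using poly_all_0_iff_0 by blast
  moreover have "char_poly A \<noteq> 0" using degree_monic_char_poly[OF A] by auto
  ultimately have "f = - q" by (simp add: eq_neg_iff_add_eq_0)
  then have F1q: "F1 x (-1) 0 = - poly q x" and F1t: "F1 1 0 0 = - t" for x
    using F1f q(2) AD by auto
  have "cnj (F1 1 0 0) = F1 1 0 0" using hermitian_formD[OF F1(2), of 1 0 0] by simp
  \<comment> \<open>\<open>- t\<close> is the value of a Hermitian form at a real point, so
    \<open>t\<close> is real; this makes \<open>H\<close> below Hermitian.\<close>
  then have t_real: "of_real (Re t) = t" unfolding F1t by (simp add: complex_eq_iff)

  show ?thesis
  proof (cases "t = 0")
    case True
    \<comment> \<open>Unitary invariance moves the condition \<open>t = 0\<close> to the Schur form: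
      its Gram trace equals the diagonal part, so \<open>T\<close> is diagonal and its adjoint is
      \<open>E\<close>.\<close>
    have "mat_trace (T * mat_adjoint T) = mat_trace (A * V)"
    proof -
      have "A * V = U * (T * mat_adjoint T) * mat_adjoint U"
        unfolding VU unfolding AU by (rule conj_mult_mat[OF U(1) W U(3) T(1) Th])
      then show ?thesis
        using mat_trace_similar[OF U(1) mult_carrier_mat[OF T(1) Th] W U(3)] by simp
    qed
    also have "\<dots> = mat_trace (A * bar A)"
      using True AD mat_trace_minus[of "A * V" n "A * bar A"] mult_minus_distrib_mat[OF A V B] A V B
      by (simp add: D_def)
    also have "\<dots> = (\<Sum>i<n. T $$ (i, i) * cnj (T $$ (i, i)))"
      using tr_bar[of 1] A by simp
    finally have "T $$ (i, j) = 0" if "i < n" "j < n" "i \<noteq> j" for i j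
      using trace_gram_upper_triangular_diagonal[OF T(1)] that by blast
    then have "mat_adjoint T = E" using T by (intro eq_matI) (auto simp: E_def)
    then have "F p u v = G p u v" for p u v
      unfolding F_def VU AU det_conj_unitary[OF U(1,2) W U(3) T(1) Th] using det_E by (simp add: G_def)
    \<comment> \<open>The second product has coefficient \<open>t = 0\<close>, so its poles are
      arbitrary, and all \<gamma> are 0.\<close>
    then show ?thesis
      unfolding pedal_F t_def[symmetric] using True pedal_G
      by (intro exI[of _ "\<lambda>_. 0"] exI[of _ "\<lambda>_. 0"] exI[of _ "\<lambda>_ _. Finite_Pole 0"]) simp
  next
    case False
    have deg: "degree q = n - 2"
      using q False AD by (intro order_antisym le_degree) auto
    obtain as where as: "smult t (\<Prod>a\<leftarrow>as. [:- a, 1:]) = q" "length as = n - 2"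
      using fundamental_theorem_algebra_factorized[of q] q(2) AD deg by auto
    \<comment> \<open>\<open>F1\<close> restricts to \<open>- q\<close>, and \<open>q\<close> is
      \<open>t\<close> times the product of its linear factors, whence the constant
      \<open>- Re t\<close>.\<close>
    define H where "H p u v = of_real (- Re t) * (\<Prod>P\<leftarrow>map Finite_Pole as. pole_form P p u v)" for p u v
    have H: "hom_form (n - 2) H" "hermitian_form H"
      using hermitian_prod_poles[where ps = "map Finite_Pole as" and c = "- Re t"] as(2) unfolding H_def[abs_def] by auto
    have "F1 x (-1) 0 = H x (-1) 0" for x
      unfolding F1q H_def prod_linear_factors_poles[symmetric] by (simp add: t_real flip: as(1))
    then obtain F2 where F2: "hom_form (n - 2 - 2) F2" "hermitian_form F2"
      "n - 2 < 2 \<longrightarrow> F2 = (\<lambda>p u v. 0)" "\<And>p u v. F1 p u v = H p u v + u * v * F2 p u v"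
      using hermitian_form_split[OF F1(1,2) H] by blast
    define m where "m = n - 2 - 2"
    obtain \<gamma> \<mu> where exp: "\<And>p \<theta> :: real. F2 (of_real p) (u \<theta>) (cnj (u \<theta>)) =
        of_real (\<Sum>k\<le>m div 2. \<gamma> k / 4 ^ k * (\<Prod>j=1..m - 2 * k. pole_pedal p \<theta> (\<mu> k j)))"
      using hermitian_form_pedal[OF F2(1,2)] unfolding u_def m_def by blast
    define ev2 where "ev2 j = as ! (j - 1)" for j
    have pedal_H: "H (of_real p) (u \<theta>) (cnj (u \<theta>)) = - t * of_real (\<Prod>j=1..n - 2. pedal p \<theta> (ev2 j))" for p \<theta>
    proof -
      have "H (of_real p) (u \<theta>) (cnj (u \<theta>)) = - t * (\<Prod>x\<leftarrow>as. of_real (pole_pedal p \<theta> (Finite_Pole x)))"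
        unfolding H_def by (simp only: map_map o_def pole of_real_minus t_real)
      then show ?thesis
        using as(2) by (simp add: ev2_def prod.list_conv_set_nth atLeast0LessThan prod.atLeast1_atMost_eq)
    qed
    \<comment> \<open>\<open>F2\<close> enters with (u v)^2 = 1/16, so its term k - 2 becomes term k
      of the theorem, whose poles carry the index k + 1. For \<open>n < 4\<close> the sum is empty
      and \<open>F2\<close> is zero; the truncated degree 0 alone would still permit a
      constant.\<close>
    have pedal_F2: "1 / 16 * F2 (of_real p) (u \<theta>) (cnj (u \<theta>)) =
        of_real (\<Sum>k=2..n div 2. \<gamma> (k - 2) / 4 ^ k * (\<Prod>j=1..n - 2 * k. pole_pedal p \<theta> (\<mu> (k + 1 - 3) j)))" for p \<theta>
    proof (cases "n < 4")
      case True
      then have "{2..n div 2} = {}" by auto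
      then show ?thesis using F2(3) True by simp
    next
      case False
      then have n2: "n div 2 = m div 2 + 2" and m: "n = m + 4" by (auto simp: m_def)
      have "(\<Sum>k=2..n div 2. \<gamma> (k - 2) / 4 ^ k * (\<Prod>j=1..n - 2 * k. pole_pedal p \<theta> (\<mu> (k + 1 - 3) j)))
          = (\<Sum>k=0 + 2..m div 2 + 2. \<gamma> (k - 2) / 4 ^ k * (\<Prod>j=1..n - 2 * k. pole_pedal p \<theta> (\<mu> (k + 1 - 3) j)))"
        unfolding n2 add_0 ..
      also have "\<dots> = (\<Sum>k=0..m div 2. 1 / 16 * (\<gamma> k / 4 ^ k * (\<Prod>j=1..m - 2 * k. pole_pedal p \<theta> (\<mu> k j))))"
        unfolding sum.shift_bounds_cl_nat_ivl by (intro sum.cong refl) (simp add: m power_add)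
      finally show ?thesis unfolding exp by (simp add: sum_distrib_left atMost_atLeast0)
    qed
    show ?thesis
    proof (intro exI[of _ "\<lambda>k. \<gamma> (k - 2)"] exI[of _ ev2] exI[of _ "\<lambda>k. \<mu> (k - 3)"] conjI allI impI exI[of _ q])
      fix p \<theta> :: real
      let ?a = "\<lambda>K. K (of_real p) (u \<theta>) (cnj (u \<theta>)) :: complex"
      have "det (pedal_mat p \<theta> A) = ?a G + 1 / 4 * (?a H + 1 / 4 * ?a F2)"
        unfolding pedal_F F1(3) F2(4) uu ..
      also have "\<dots> = ?a G + 1 / 4 * ?a H + 1 / 16 * ?a F2"
        by (simp add: algebra_simps)
      finally show "det (pedal_mat p \<theta> A) = of_real (\<Prod>j=1..n. pedal p \<theta> (ev j))
         - t_coeff bar 1 A / 4 * of_real (\<Prod>j=1..n-2. pedal p \<theta> (ev2 j))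
         + of_real (\<Sum>k=2..n div 2. \<gamma> (k - 2) / 4 ^ k * (\<Prod>j=1..n-2*k. pole_pedal p \<theta> (\<mu> (k + 1 - 3) j)))"
        unfolding pedal_F2 pedal_G pedal_H t_def[symmetric] by simp
    next
      show "q \<noteq> 0" using q(2) AD False by auto
      show "poly q x = mat_trace (adj_mat (x \<cdot>\<^sub>m 1\<^sub>m n - A) * (mat_adjoint A - bar A))" for x
        using pq by (simp add: D_def V_def)
      \<comment> \<open>The constant \<open>t\<close> is nonzero and does not affect orders, so the
        multiplicity of z is its number of occurrences in \<open>as\<close>.\<close>
      show "order z q = card {j \<in> {1..n - 2}. ev2 j = z}" for z
        using order_prod_linear_factors[of z as] as False by (simp add: ev2_def order_smult flip: as(1))
    qed
  qed
qed

end
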